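(* Let $\omega\in(2^{\mathbb N})^{\mathbb N}$ be Schnorr random. The following are equivalent: (1) $(M_n(\omega))$ diverges as $n\to\infty$ for some computable nonnegative martingale $(M_n)$ that has a computable bound on its growth, i.e. a computable $d:\mathbb N\to\mathbb R$ with $\|M_n\|_\infty\le d(n)$ for all $n$; (2) $\omega$ is not Doob random; (3) $(M_n(\omega))$ diverges as $n\to\infty$ for some a.e. computable nonnegative martingale $(M_n)$.
   Context: $(2^{\mathbb N})^{\mathbb N}$ carries the uniform (fair-coin product) measure $\mathbb P$. $\omega_{<n}=(\omega_0,\dots,\omega_{n-1})$, $\omega_{<n}{}^\frown\xi=(\omega_0,\dots,\omega_{n-1},\xi_0,\xi_1,\dots)$, $\mathbb E_n(f)(\omega)=\int f(\omega_{<n}{}^\frown\xi)\,d\mathbb P(\xi)$. A martingale is a sequence $(M_n)$ of integrable real functions with $M_n(\omega)$ a.s. depending only on $n$ and $\omega_{<n}$ and $\mathbb E_m(M_n)=M_m$ for $m\le n$; computable if $M_n(\omega)$ is uniformly computable from $n$ and $\omega_{<n}$; a.e. computable if $M_n(\omega)$ is a.e. computable uniformly from $n$ and $\omega_{<n}$ (equivalently $M_n$ is a.e. computable uniformly in $n$), where an a.e. computable function is a partial computable function whose domain contains a $\Pi^0_2$ set of measure one. $\omega$ is Doob random if $(M_n(\omega))$ converges to a real number for every nonnegative computable martingale. $\omega$ is Schnorr random if $\bigoplus_n\omega_n$ lies in no $\bigcap_kU_k$ for a computable sequence of effectively open $U_k$ with measures $\le2^{-k}$ computable uniformly in $k$.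 "Diverges" means does not converge to a real number. *)

theory Defs
  imports "HOL-Probability.Probability" "HOL-Library.Nat_Bijection"
begin

text \<open>
  Oracle programs: unary partial recursive functions relative to an oracle, with tuples of
  arguments coded by \<^const>\<open>prod_encode\<close>. \<open>PrecP f g\<close> is primitive recursion, whose
  argument codes (parameter, recursion argument), and \<open>MuP f\<close> is unbounded minimization.
\<close>

datatype prog =
    ZeroP | SuccP | FstP | SndP | OracleP
  | PairP prog prog | CompP prog prog | PrecP prog prog | MuP prog

primrec run :: "(nat \<Rightarrow> nat) \<Rightarrow> prog \<Rightarrow> nat \<Rightarrow> nat option" where
  "run A ZeroP x = Some 0"
| "run A SuccP x = Some (Suc x)"
| "run A FstP x = Some (fst (prod_decode x))"
| "run A SndP x = Some (snd (prod_decode x))"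
| "run A OracleP x = Some (A x)"
| "run A (PairP f g) x =
     Option.bind (run A f x) (\<lambda>y. Option.bind (run A g x) (\<lambda>z. Some (prod_encode (y, z))))"
| "run A (CompP f g) x = Option.bind (run A g x) (run A f)"
| "run A (PrecP f g) x =
     rec_nat (run A f (fst (prod_decode x)))
       (\<lambda>m r. Option.bind r
          (\<lambda>y. run A g (prod_encode (fst (prod_decode x), prod_encode (m, y)))))
       (snd (prod_decode x))"
| "run A (MuP f) x =
     (if \<exists>n. run A f (prod_encode (x, n)) = Some 0 \<and>
             (\<forall>m<n. run A f (prod_encode (x, m)) \<noteq> None)
      then Some (LEAST n. run A f (prod_encode (x, n)) = Some 0)
      else None)"

definition no_oracle :: "nat \<Rightarrow> nat" where
  "no_oracle = (\<lambda>_. 0)"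

text \<open>
  With oracle \<open>A\<close> and index \<open>n\<close>, the program \<open>p\<close> computes a fast Cauchy name of \<open>x\<close>;
  rationals are coded by the surjection \<^const>\<open>nat_to_rat_surj\<close>.
\<close>

definition computes_real :: "prog \<Rightarrow> (nat \<Rightarrow> nat) \<Rightarrow> nat \<Rightarrow> real \<Rightarrow> bool" where
  "computes_real p A n x \<longleftrightarrow>
     (\<forall>k. \<exists>c. run A p (prod_encode (n, k)) = Some c \<and>
              \<bar>of_rat (nat_to_rat_surj c) - x\<bar> \<le> 1 / 2 ^ k)"

definition computable_real_seq :: "(nat \<Rightarrow> real) \<Rightarrow> bool" where
  "computable_real_seq d \<longleftrightarrow> (\<exists>p. \<forall>n. computes_real p no_oracle n (d n))"

type_synonym cantor = "nat \<Rightarrow> bool"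

definition cantor_measure :: "cantor measure" where
  "cantor_measure = PiM UNIV (\<lambda>_. measure_pmf (bernoulli_pmf (1/2)))"

definition seq_measure :: "(nat \<Rightarrow> cantor) measure" where
  "seq_measure = PiM UNIV (\<lambda>_. cantor_measure)"

definition join :: "(nat \<Rightarrow> cantor) \<Rightarrow> cantor" where
  "join \<omega> m = \<omega> (fst (prod_decode m)) (snd (prod_decode m))"

definition cylinder :: "bool list \<Rightarrow> cantor set" where
  "cylinder \<sigma> = {x. \<forall>i<length \<sigma>. x i = \<sigma> ! i}"

text \<open>
  Computable sequences of effectively open subsets of Cantor space: \<open>U k\<close> is the union of the
  cylinders over a set of strings which is c.e. uniformly in \<open>k\<close>, a c.e. set being the domain
  of a partial recursive function.
\<close>

definition effectively_open_seq :: "(nat \<Rightarrow> cantor set) \<Rightarrow> bool" where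
  "effectively_open_seq U \<longleftrightarrow>
     (\<exists>p. \<forall>k. U k =
        (\<Union>\<sigma>\<in>{\<sigma>. run no_oracle p (prod_encode (k, list_encode (map of_bool \<sigma>))) \<noteq> None}.
           cylinder \<sigma>))"

definition schnorr_random :: "(nat \<Rightarrow> cantor) \<Rightarrow> bool" where
  "schnorr_random \<omega> \<longleftrightarrow>
     \<not> (\<exists>U. effectively_open_seq U \<and>
            (\<forall>k. measure cantor_measure (U k) \<le> 1 / 2 ^ k) \<and>
            computable_real_seq (\<lambda>k. measure cantor_measure (U k)) \<and>
            join \<omega> \<in> (\<Inter>k. U k))"

text \<open>The effective topology of the product is transported along the homeomorphism \<^const>\<open>join\<close>.\<close>

definition Pi02 :: "(nat \<Rightarrow> cantor) set \<Rightarrow> bool" where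
  "Pi02 D \<longleftrightarrow> (\<exists>U. effectively_open_seq U \<and> D = (\<Inter>k. join -` U k))"

definition initial :: "nat \<Rightarrow> (nat \<Rightarrow> cantor) \<Rightarrow> cantor list" where
  "initial n \<omega> = map \<omega> [0..<n]"

definition initial_oracle :: "cantor list \<Rightarrow> nat \<Rightarrow> nat" where
  "initial_oracle xs m =
     (let (i, j) = prod_decode m in if i < length xs then of_bool ((xs ! i) j) else 0)"

definition cond_exp :: "nat \<Rightarrow> ((nat \<Rightarrow> cantor) \<Rightarrow> real) \<Rightarrow> (nat \<Rightarrow> cantor) \<Rightarrow> real" where
  "cond_exp n f \<omega> = (\<integral>\<xi>. f (comb_seq n \<omega> \<xi>) \<partial>seq_measure)"

definition martingale :: "(nat \<Rightarrow> (nat \<Rightarrow> cantor) \<Rightarrow> real) \<Rightarrow> bool" where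
  "martingale M \<longleftrightarrow>
     (\<forall>n. integrable seq_measure (M n)) \<and>
     (\<forall>n. \<exists>g. AE \<omega> in seq_measure. M n \<omega> = g (initial n \<omega>)) \<and>
     (\<forall>m n. m \<le> n \<longrightarrow> (AE \<omega> in seq_measure. cond_exp m (M n) \<omega> = M m \<omega>))"

definition nonneg_martingale :: "(nat \<Rightarrow> (nat \<Rightarrow> cantor) \<Rightarrow> real) \<Rightarrow> bool" where
  "nonneg_martingale M \<longleftrightarrow> martingale M \<and> (\<forall>n \<omega>. 0 \<le> M n \<omega>)"

definition computable_process :: "(nat \<Rightarrow> (nat \<Rightarrow> cantor) \<Rightarrow> real) \<Rightarrow> bool" where
  "computable_process M \<longleftrightarrow>
     (\<exists>p. \<forall>n \<omega>. computes_real p (initial_oracle (initial n \<omega>)) n (M n \<omega>))"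

text \<open>
  A partial function defined almost everywhere is represented by a total function; only its
  values on the set \<open>D\<close> are constrained by computability. Every Schnorr random point lies in
  each \<open>\<Pi>\<^sup>0\<^sub>2\<close> set of measure one, so the values at these points are the computed ones.
\<close>

definition ae_computable_process :: "(nat \<Rightarrow> (nat \<Rightarrow> cantor) \<Rightarrow> real) \<Rightarrow> bool" where
  "ae_computable_process M \<longleftrightarrow>
     (\<exists>p. \<forall>n. \<exists>D. Pi02 D \<and> measure seq_measure D = 1 \<and>
        (\<forall>\<omega>\<in>D. computes_real p (initial_oracle (initial n \<omega>)) n (M n \<omega>)))"

definition doob_random :: "(nat \<Rightarrow> cantor) \<Rightarrow> bool" where
  "doob_random \<omega> \<longleftrightarrow>
     (\<forall>M. nonneg_martingale M \<and> computable_process M \<longrightarrow> convergent (\<lambda>n. M n \<omega>))"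

end

theory Submission
  imports Defs
begin

text \<open>
  Run the program of an a.e. computable martingale \<open>M\<close> for a bounded time on finitely many bits. As
  \<open>\<integral>M\<^sub>n = M\<^sub>0\<close> is a computable number and \<open>M\<^sub>n \<ge> 0\<close>, one can search for a time after which the values found so
  far give a dyadic step function \<open>f\<^sub>n\<close> with \<open>\<parallel>f\<^sub>n - M\<^sub>n\<parallel>\<^sub>1 \<le> 16 / 2\<^sup>2\<^sup>n\<^sup>+\<^sup>5\<close> which is close to \<open>M\<^sub>n\<close> outside a clopen
  set of measure at most \<open>1 / 2\<^sup>n\<close>. Then \<open>f\<^sub>n(\<omega>) - M\<^sub>n(\<omega>) \<rightarrow> 0\<close> at Schnorr random points, by an effective
  Borel-Cantelli lemma. The \<open>f\<^sub>n\<close> do not form a martingale, but \<open>e\<^sub>n = \<bar>E\<^sub>n(f\<^sub>n\<^sub>+\<^sub>1) - f\<^sub>n\<bar>\<close> is so small in \<open>L\<^sup>1\<close> that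
  \<open>\<Sum>e\<^sub>n(\<omega>)\<close> converges at Schnorr random points. Summing the increments \<open>f\<^sub>n\<^sub>+\<^sub>1 - E\<^sub>n(f\<^sub>n\<^sub>+\<^sub>1)\<close> from
  \<open>C + f\<^sub>0\<close>, and stopping before the predictable sum \<open>\<Sum>e\<^sub>n\<close> exceeds \<open>C\<close>, gives a computable nonnegative
  martingale with a computable bound. For \<open>C\<close> large it is not stopped at \<open>\<omega>\<close>, where it then differs
  from \<open>f\<^sub>n(\<omega>)\<close> by a convergent sequence.
\<close>

subsection \<open>Total recursive functionals\<close>

text \<open>The obstacle is that at any stage the program may be undecided on a set which is small
  but carries much of the mass of \<open>M_n\<close>, so smallness in measure does not bound the L1
  error. Undecided strings therefore get the value 0: the step function overshoots
  \<open>M_n\<close> only by rounding, and up to rounding the L1 distance is a difference of two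
  integrals, one known in advance, the other a finite average.

  After that search all work is done with exact rational step functions. This makes the stopping
  rule decidable, which a comparison of computable reals would not be. The test is settled before
  the increment that it controls, so the martingale identity survives stopping.

  The exponent 2n+5 is chosen for Markov's inequality: e_n has integral at most 4^(-n), so it
  exceeds 2^(-n) only on a clopen set of measure at most 2^(-n). The measure of a clopen set can be
  counted, so tail unions of such sets form a Schnorr test. The constant C depends on \<omega> and
  need not be found effectively: any natural number above the sum of the e_n(\<omega>) will do, and
  one number can be built into a program.\<close>

definition pfst :: "nat \<Rightarrow> nat" where "pfst z = fst (prod_decode z)"
definition psnd :: "nat \<Rightarrow> nat" where "psnd z = snd (prod_decode z)"

lemma pfst_prod_encode [simp]: "pfst (prod_encode (a, b)) = a"
  by (simp add: pfst_def)

lemma psnd_prod_encode [simp]: "psnd (prod_encode (a, b)) = b"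
  by (simp add: psnd_def)

lemma prod_encode_pfst_psnd [simp]: "prod_encode (pfst z, psnd z) = z"
  by (simp add: pfst_def psnd_def)

text \<open>Halting is demanded for every oracle, so composition never meets an undefined value;
  partial programs are reached only through minimization and the bounded simulation
  \<open>sim\<close>.\<close>

definition recursive :: "((nat \<Rightarrow> nat) \<Rightarrow> nat \<Rightarrow> nat) \<Rightarrow> bool" where
  "recursive F \<longleftrightarrow> (\<exists>p. \<forall>A x. run A p x = Some (F A x))"

definition decidable :: "((nat \<Rightarrow> nat) \<Rightarrow> nat \<Rightarrow> bool) \<Rightarrow> bool" where
  "decidable P \<longleftrightarrow> recursive (\<lambda>A x. of_bool (P A x))"

named_theorems rec_intros

lemma recursiveI: "(\<And>A x. run A p x = Some (F A x)) \<Longrightarrow> recursive F"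
  unfolding recursive_def by blast

lemma recursive_comp:
  assumes "recursive f" "recursive g"
  shows "recursive (\<lambda>A x. f A (g A x))"
proof -
  obtain p q where "\<And>A x. run A p x = Some (f A x)" "\<And>A x. run A q x = Some (g A x)"
    using assms unfolding recursive_def by blast
  then show ?thesis by (intro recursiveI[where p = "CompP p q"]) simp
qed

lemma recursive_arg [rec_intros]: "recursive (\<lambda>A x. x)"
  \<comment> \<open>The language has no identity program; pairing the two projections again supplies
    one.\<close>
  by (rule recursiveI[where p = "PairP FstP SndP"]) simp

lemma recursive_const [rec_intros]: "recursive (\<lambda>A x. c)"
proof (induction c)
  case 0
  show ?case by (rule recursiveI[where p = ZeroP]) simp
next
  case (Suc c)
  have "recursive (\<lambda>A. Suc)" by (rule recursiveI[where p = SuccP]) simp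
  from recursive_comp[OF this Suc] show ?case .
qed

lemma recursive_Suc [rec_intros]:
  assumes "recursive f" shows "recursive (\<lambda>A x. Suc (f A x))"
proof -
  have "recursive (\<lambda>A. Suc)" by (rule recursiveI[where p = SuccP]) simp
  from recursive_comp[OF this assms] show ?thesis .
qed

lemma recursive_pfst [rec_intros]:
  assumes "recursive f" shows "recursive (\<lambda>A x. pfst (f A x))"
proof -
  have "recursive (\<lambda>A. pfst)" by (rule recursiveI[where p = FstP]) (simp add: pfst_def)
  from recursive_comp[OF this assms] show ?thesis .
qed

lemma recursive_psnd [rec_intros]:
  assumes "recursive f" shows "recursive (\<lambda>A x. psnd (f A x))"
proof -
  have "recursive (\<lambda>A. psnd)" by (rule recursiveI[where p = SndP]) (simp add: psnd_def)
  from recursive_comp[OF this assms] show ?thesis .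
qed

lemma recursive_oracle [rec_intros]:
  assumes "recursive f" shows "recursive (\<lambda>A x. A (f A x))"
proof -
  have "recursive (\<lambda>A x. A x)" by (rule recursiveI[where p = OracleP]) simp
  from recursive_comp[OF this assms] show ?thesis .
qed

lemma recursive_prod_encode [rec_intros]:
  assumes "recursive f" "recursive g"
  shows "recursive (\<lambda>A x. prod_encode (f A x, g A x))"
proof -
  obtain p q where "\<And>A x. run A p x = Some (f A x)" "\<And>A x. run A q x = Some (g A x)"
    using assms unfolding recursive_def by blast
  then show ?thesis by (intro recursiveI[where p = "PairP p q"]) simp
qed

text \<open>Functions of several arguments appear as unary functions of a pair code; this rule
  restores the curried form, which is what occurs under binders.\<close>

lemma recursive_comp2:
  assumes "recursive (\<lambda>A z. h A (pfst z) (psnd z))" "recursive f" "recursive g"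
  shows "recursive (\<lambda>A x. h A (f A x) (g A x))"
  using recursive_comp[OF assms(1) recursive_prod_encode[OF assms(2,3)]] by simp

lemma decidable_comp2:
  assumes "decidable (\<lambda>A z. h A (pfst z) (psnd z))" "recursive f" "recursive g"
  shows "decidable (\<lambda>A x. h A (f A x) (g A x))"
  using recursive_comp2[where h = "\<lambda>A x y. of_bool (h A x y)"] assms unfolding decidable_def by blast

lemma recursive_rec_nat [rec_intros]:
  assumes "recursive f" "recursive (\<lambda>A z. g A (pfst z) (pfst (psnd z)) (psnd (psnd z)))" "recursive b"
  shows "recursive (\<lambda>A x. rec_nat (f A x) (g A x) (b A x))"
proof -
  obtain p q where p: "\<And>A x. run A p x = Some (f A x)"
    and q: "\<And>A z. run A q z = Some (g A (pfst z) (pfst (psnd z)) (psnd (psnd z)))"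
    using assms unfolding recursive_def by blast
  have "rec_nat (Some (f A x)) (\<lambda>m r. Option.bind r (\<lambda>y. run A q (prod_encode (x, prod_encode (m, y))))) n
      = Some (rec_nat (f A x) (g A x) n)" for A x n
    by (induction n) (simp_all add: q)
  then have "recursive (\<lambda>A z. rec_nat (f A (pfst z)) (g A (pfst z)) (psnd z))"
    by (intro recursiveI[where p = "PrecP p q"]) (simp add: p pfst_def psnd_def)
  from recursive_comp2[OF this recursive_arg assms(3)] show ?thesis .
qed

lemma recursive_LEAST:
  assumes "decidable (\<lambda>A z. P A (pfst z) (psnd z))" "\<And>A x. \<exists>n. P A x n"
  shows "recursive (\<lambda>A x. LEAST n. P A x n)"
proof -
  \<comment> \<open>\<open>MuP\<close> looks for the value \<open>0\<close>, so the truth values are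
    exchanged first, by a primitive recursion that sends \<open>0\<close> to \<open>1\<close> and
    \<open>1\<close> to \<open>0\<close>.\<close>
  have *: "recursive (\<lambda>A z. rec_nat 1 (\<lambda>_ _. 0) (of_bool (P A (pfst z) (psnd z))))"
    by (intro rec_intros assms(1)[unfolded decidable_def])
  have "rec_nat 1 (\<lambda>_ _. 0) (of_bool Q) = (of_bool (\<not> Q) :: nat)" for Q by (cases Q) auto
  then obtain p where p: "\<And>A z. run A p z = Some (of_bool (\<not> P A (pfst z) (psnd z)))"
    using * unfolding recursive_def by auto
  have "run A (MuP p) x = Some (LEAST n. P A x n)" for A x
    using assms(2)[of A x] by (auto simp: p)
  then show ?thesis by (rule recursiveI)
qed

text \<open>An unbounded search for a witness halts exactly when there is one. This provides the
  c.e. sets of strings that effectively open sets require.\<close>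

lemma semidecidable_domain:
  assumes "decidable (\<lambda>A z. P A (pfst z) (psnd z))"
  shows "\<exists>p. \<forall>A x. run A p x \<noteq> None \<longleftrightarrow> (\<exists>n. P A x n)"
proof -
  have *: "recursive (\<lambda>A z. rec_nat 1 (\<lambda>_ _. 0) (of_bool (P A (pfst z) (psnd z))))"
    by (intro rec_intros assms(1)[unfolded decidable_def])
  have "rec_nat 1 (\<lambda>_ _. 0) (of_bool Q) = (of_bool (\<not> Q) :: nat)" for Q by (cases Q) auto
  then obtain p where p: "\<And>A z. run A p z = Some (of_bool (\<not> P A (pfst z) (psnd z)))"
    using * unfolding recursive_def by auto
  have "run A (MuP p) x \<noteq> None \<longleftrightarrow> (\<exists>n. P A x n)" for A x
    by (auto simp: p)
  then show ?thesis by blast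
qed

section \<open>Closure under arithmetic, case distinction and bounded quantifiers\<close>

lemma recursive_cong:
  assumes "recursive f" "\<And>A x. f A x = g A x"
  shows "recursive g"
  using assms by (auto simp: recursive_def)

lemma recursive_add [rec_intros]:
  assumes "recursive f" "recursive g"
  shows "recursive (\<lambda>A x. f A x + g A x)"
proof -
  have "recursive (\<lambda>A x. rec_nat (f A x) (\<lambda>m r. Suc r) (g A x))"
    by (intro rec_intros assms)
  moreover have "rec_nat a (\<lambda>m r. Suc r) b = a + b" for a b by (induction b) auto
  ultimately show ?thesis by simp
qed

lemma recursive_mult [rec_intros]:
  assumes "recursive f" "recursive g"
  shows "recursive (\<lambda>A x. f A x * g A x)"
proof -
  have "recursive (\<lambda>A x. rec_nat 0 (\<lambda>m r. r + f A x) (g A x))"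
    by (intro rec_intros assms recursive_comp[OF assms(1)])
  moreover have "rec_nat 0 (\<lambda>m r. r + a) b = a * b" for a b :: nat by (induction b) auto
  ultimately show ?thesis by simp
qed

lemma recursive_power [rec_intros]:
  assumes "recursive f" "recursive g"
  shows "recursive (\<lambda>A x. f A x ^ g A x)"
proof -
  have "recursive (\<lambda>A x. rec_nat 1 (\<lambda>m r. r * f A x) (g A x))"
    by (intro rec_intros assms recursive_comp[OF assms(1)])
  moreover have "rec_nat 1 (\<lambda>m r. r * a) b = a ^ b" for a b :: nat by (induction b) auto
  ultimately show ?thesis by simp
qed

lemma recursive_diff [rec_intros]:
  assumes "recursive f" "recursive g"
  shows "recursive (\<lambda>A x. f A x - g A x)"
proof -
  have 1: "recursive (\<lambda>A x. rec_nat 0 (\<lambda>m r. m) x)"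
    by (intro rec_intros)
  have "rec_nat 0 (\<lambda>m r. m) x = x - 1" for x by (cases x) auto
  with 1 have 2: "recursive (\<lambda>A x. x - 1)" by simp
  have "recursive (\<lambda>A x. rec_nat (f A x) (\<lambda>m r. r - 1) (g A x))"
    by (intro rec_intros assms recursive_comp[OF 2])
  moreover have "rec_nat a (\<lambda>m r. r - 1) b = a - b" for a b :: nat by (induction b) auto
  ultimately show ?thesis by simp
qed

lemma recursive_sum [rec_intros]:
  assumes "recursive (\<lambda>A z. f A (pfst z) (psnd z))" "recursive b"
  shows "recursive (\<lambda>A x. \<Sum>i<b A x. f A x i)"
proof -
  have "recursive (\<lambda>A x. rec_nat 0 (\<lambda>m r. r + f A x m) (b A x))"
    by (intro rec_intros assms recursive_comp2[OF assms(1)])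
  moreover have "rec_nat 0 (\<lambda>m r. r + h m) n = sum h {..<n}" for h :: "nat \<Rightarrow> nat" and n by (induction n) auto
  ultimately show ?thesis by simp
qed

lemma recursive_prod [rec_intros]:
  assumes "recursive (\<lambda>A z. f A (pfst z) (psnd z))" "recursive b"
  shows "recursive (\<lambda>A x. \<Prod>i<b A x. f A x i)"
proof -
  have "recursive (\<lambda>A x. rec_nat 1 (\<lambda>m r. r * f A x m) (b A x))"
    by (intro rec_intros assms recursive_comp2[OF assms(1)])
  moreover have "rec_nat 1 (\<lambda>m r. r * h m) n = prod h {..<n}" for h :: "nat \<Rightarrow> nat" and n
    by (induction n) auto
  ultimately show ?thesis by simp
qed

lemma recursive_of_bool [rec_intros]: "decidable P \<Longrightarrow> recursive (\<lambda>A x. of_bool (P A x))"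
  by (simp add: decidable_def)

lemma decidable_not [rec_intros]:
  assumes "decidable P" shows "decidable (\<lambda>A x. \<not> P A x)"
proof -
  have "recursive (\<lambda>A x. 1 - of_bool (P A x))" by (intro rec_intros assms)
  then show ?thesis unfolding decidable_def by (rule recursive_cong) simp
qed

lemma decidable_le [rec_intros]:
  assumes "recursive f" "recursive g"
  shows "decidable (\<lambda>A x. f A x \<le> g A x)"
proof -
  have "recursive (\<lambda>A x. 1 - (f A x - g A x))" by (intro rec_intros assms)
  then show ?thesis unfolding decidable_def by (rule recursive_cong) auto
qed

lemma decidable_less [rec_intros]:
  assumes "recursive f" "recursive g"
  shows "decidable (\<lambda>A x. f A x < g A x)"
  using decidable_not[OF decidable_le[OF assms(2,1)]] by (simp add: not_le)

lemma decidable_conj [rec_intros]: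
  assumes "decidable P" "decidable Q"
  shows "decidable (\<lambda>A x. P A x \<and> Q A x)"
proof -
  have "recursive (\<lambda>A x. of_bool (P A x) * of_bool (Q A x))" by (intro rec_intros assms)
  then show ?thesis unfolding decidable_def by (rule recursive_cong) simp
qed

lemma decidable_eq [rec_intros]:
  assumes "recursive f" "recursive g"
  shows "decidable (\<lambda>A x. f A x = g A x)"
proof -
  have "decidable (\<lambda>A x. f A x \<le> g A x \<and> g A x \<le> f A x)" by (intro rec_intros assms)
  moreover have "(a \<le> b \<and> b \<le> a) = (a = b)" for a b :: nat by auto
  ultimately show ?thesis by simp
qed

lemma recursive_if [rec_intros]:
  assumes "decidable P" "recursive f" "recursive g"
  shows "recursive (\<lambda>A x. if P A x then f A x else g A x)"
proof -
  have "recursive (\<lambda>A x. of_bool (P A x) * f A x + of_bool (\<not> P A x) * g A x)"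
    by (intro rec_intros assms)
  then show ?thesis by (rule recursive_cong) simp
qed

lemma decidable_if [rec_intros]:
  assumes "decidable P" "decidable f" "decidable g"
  shows "decidable (\<lambda>A x. if P A x then f A x else g A x)"
proof -
  have "recursive (\<lambda>A x. if P A x then of_bool (f A x) else of_bool (g A x))"
    by (intro rec_intros assms)
  then show ?thesis unfolding decidable_def by (rule recursive_cong) auto
qed

lemma decidable_Ex_less [rec_intros]:
  assumes "decidable (\<lambda>A z. P A (pfst z) (psnd z))" "recursive b"
  shows "decidable (\<lambda>A x. \<exists>i<b A x. P A x i)"
proof -
  have "decidable (\<lambda>A x. 0 < (\<Sum>i<b A x. of_bool (P A x i) :: nat))"
    by (intro rec_intros assms)
  moreover have "0 < (\<Sum>i<b. of_bool (P i) :: nat) \<longleftrightarrow> (\<exists>i<b. P i)" for b :: nat and P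
    by (induction b) (auto simp: less_Suc_eq)
  ultimately show ?thesis by (simp only:)
qed

lemma decidable_All_less [rec_intros]:
  assumes "decidable (\<lambda>A z. P A (pfst z) (psnd z))" "recursive b"
  shows "decidable (\<lambda>A x. \<forall>i<b A x. P A x i)"
proof -
  have "decidable (\<lambda>A x. \<not> (\<exists>i<b A x. \<not> P A x i))"
    by (intro rec_intros assms)
  then show ?thesis by simp
qed

lemma recursive_div [rec_intros]:
  assumes "recursive f" "recursive g"
  shows "recursive (\<lambda>A x. f A x div g A x)"
proof -
  \<comment> \<open>The quotient counts the \<open>q\<close> with \<open>Suc q * b \<le> a\<close>;
    for \<open>b > 0\<close> all of these lie below \<open>a\<close>.\<close>
  have "recursive (\<lambda>A x. if g A x = 0 then 0 else (\<Sum>q<f A x. of_bool (Suc q * g A x \<le> f A x)))"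
    by (intro rec_intros assms recursive_comp[OF assms(1)] recursive_comp[OF assms(2)])
  moreover have "(if b = 0 then 0 else (\<Sum>q<a. of_bool (Suc q * b \<le> a))) = a div b" for a b :: nat
  proof (cases "b = 0")
    case False
    have "(\<Sum>q<a. of_bool (Suc q * b \<le> a)) = card ({..<a} \<inter> {q. Suc q * b \<le> a})"
      by (simp add: sum.If_cases of_bool_def)
    also have "{..<a} \<inter> {q. Suc q * b \<le> a} = {..<a div b}"
    proof (rule set_eqI)
      fix q
      have "Suc q * b \<le> a \<longleftrightarrow> Suc q \<le> a div b" using False
        by (metis less_eq_div_iff_mult_less_eq neq0_conv)
      moreover have "Suc q \<le> a div b \<Longrightarrow> q < a"
        by (meson Suc_le_lessD div_le_dividend le_trans)
      ultimately show "q \<in> {..<a} \<inter> {q. Suc q * b \<le> a} \<longleftrightarrow> q \<in> {..<a div b}" by auto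
    qed
    finally show ?thesis using False by simp
  qed simp
  ultimately show ?thesis by simp
qed

lemma recursive_mod [rec_intros]:
  assumes "recursive f" "recursive g"
  shows "recursive (\<lambda>A x. f A x mod g A x)"
proof -
  have "recursive (\<lambda>A x. f A x - f A x div g A x * g A x)" by (intro rec_intros assms)
  then show ?thesis by (simp add: minus_div_mult_eq_mod)
qed

lemma decidable_odd [rec_intros]:
  assumes "recursive f" shows "decidable (\<lambda>A x. odd (f A x))"
proof -
  have "decidable (\<lambda>A x. f A x mod 2 = 1)" by (intro rec_intros assms)
  then show ?thesis by (simp add: odd_iff_mod_2_eq_one)
qed

lemma decidable_bit [rec_intros]:
  assumes "recursive f" "recursive g" shows "decidable (\<lambda>A x. bit (f A x) (g A x))"
  unfolding bit_iff_odd by (intro rec_intros assms)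

lemma recursive_take_bit [rec_intros]:
  assumes "recursive f" "recursive g" shows "recursive (\<lambda>A x. take_bit (f A x) (g A x))"
  unfolding take_bit_eq_mod by (intro rec_intros assms)

subsection \<open>Rational-valued functions\<close>

text \<open>A difference of naturals over a positive natural avoids coded signs, and comparisons
  reduce to naturals by cross-multiplication. The value is exact, not a limit.\<close>

definition recursive_rat :: "((nat \<Rightarrow> nat) \<Rightarrow> nat \<Rightarrow> real) \<Rightarrow> bool" where
  "recursive_rat F \<longleftrightarrow> (\<exists>a b c. recursive a \<and> recursive b \<and> recursive c \<and>
     (\<forall>A x. c A x > 0 \<and> F A x = (real (a A x) - real (b A x)) / real (c A x)))"

lemma recursive_ratE:
  assumes "recursive_rat F"
  obtains a b c where "recursive a" "recursive b" "recursive c" "\<And>A x. c A x > 0"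
    "\<And>A x. F A x = (real (a A x) - real (b A x)) / real (c A x)"
  using assms unfolding recursive_rat_def by blast

lemma recursive_ratI:
  assumes "recursive a" "recursive b" "recursive c" "\<And>A x. c A x > 0"
    "\<And>A x. F A x = (real (a A x) - real (b A x)) / real (c A x)"
  shows "recursive_rat F"
  using assms unfolding recursive_rat_def by blast

lemma recursive_rat_of_nat [rec_intros]:
  "recursive f \<Longrightarrow> recursive_rat (\<lambda>A x. real (f A x))"
  by (rule recursive_ratI[where a = f and b = "\<lambda>_ _. 0" and c = "\<lambda>_ _. 1"]) (auto intro: rec_intros)

lemma recursive_rat_const [rec_intros]:
  "recursive_rat (\<lambda>A x. 0)" "recursive_rat (\<lambda>A x. 1)" "recursive_rat (\<lambda>A x. numeral w)"
  using recursive_rat_of_nat[OF recursive_const[of 0]] recursive_rat_of_nat[OF recursive_const[of 1]]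
    recursive_rat_of_nat[OF recursive_const[of "numeral w"]] by simp_all

lemma recursive_rat_comp:
  assumes "recursive_rat F" "recursive g"
  shows "recursive_rat (\<lambda>A x. F A (g A x))"
  using assms(1)
proof (rule recursive_ratE)
  fix a b c assume *: "recursive a" "recursive b" "recursive c" "\<And>A x. c A x > 0"
    "\<And>A x. F A x = (real (a A x) - real (b A x)) / real (c A x)"
  show ?thesis
    by (rule recursive_ratI[OF recursive_comp[OF *(1) assms(2)] recursive_comp[OF *(2) assms(2)]
          recursive_comp[OF *(3) assms(2)]]) (auto simp: *)
qed

lemma recursive_rat_comp2:
  assumes "recursive_rat (\<lambda>A z. h A (pfst z) (psnd z))" "recursive f" "recursive g"
  shows "recursive_rat (\<lambda>A x. h A (f A x) (g A x))"
  using recursive_rat_comp[OF assms(1) recursive_prod_encode[OF assms(2,3)]] by simp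

lemma recursive_rat_add [rec_intros]:
  assumes "recursive_rat F" "recursive_rat G"
  shows "recursive_rat (\<lambda>A x. F A x + G A x)"
proof -
  from assms obtain a b c a' b' c' where [rec_intros]: "recursive a" "recursive b" "recursive c"
    "recursive a'" "recursive b'" "recursive c'"
    and *: "\<And>A x. c A x > 0" "\<And>A x. c' A x > 0"
    "\<And>A x. F A x = (real (a A x) - real (b A x)) / real (c A x)"
    "\<And>A x. G A x = (real (a' A x) - real (b' A x)) / real (c' A x)"
    by (elim recursive_ratE) blast
  show ?thesis
  proof (rule recursive_ratI)
    show "recursive (\<lambda>A x. a A x * c' A x + a' A x * c A x)"
      "recursive (\<lambda>A x. b A x * c' A x + b' A x * c A x)" "recursive (\<lambda>A x. c A x * c' A x)"
      by (intro rec_intros)+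
  qed (use *(1,2) in \<open>auto simp: *(3,4) field_simps less_imp_neq[THEN not_sym]\<close>)
qed

lemma recursive_rat_minus [rec_intros]:
  assumes "recursive_rat F" shows "recursive_rat (\<lambda>A x. - F A x)"
  using assms
proof (rule recursive_ratE)
  fix a b c assume *: "recursive a" "recursive b" "recursive c" "\<And>A x. c A x > 0"
    "\<And>A x. F A x = (real (a A x) - real (b A x)) / real (c A x)"
  show ?thesis by (rule recursive_ratI[OF *(2,1,3,4)]) (simp add: * minus_divide_left)
qed

lemma recursive_rat_diff [rec_intros]:
  assumes "recursive_rat F" "recursive_rat G"
  shows "recursive_rat (\<lambda>A x. F A x - G A x)"
  using recursive_rat_add[OF assms(1) recursive_rat_minus[OF assms(2)]] by simp

lemma recursive_rat_divide_power [rec_intros]: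
  assumes "recursive_rat F" "recursive k"
  shows "recursive_rat (\<lambda>A x. F A x / 2 ^ k A x)"
  using assms(1)
proof (rule recursive_ratE)
  fix a b c assume *: "recursive a" "recursive b" "recursive c" "\<And>A x. c A x > 0"
    "\<And>A x. F A x = (real (a A x) - real (b A x)) / real (c A x)"
  have "recursive (\<lambda>A x. c A x * 2 ^ k A x)" by (intro rec_intros * assms)
  then show ?thesis by (rule recursive_ratI[OF *(1,2)]) (auto simp: *)
qed

lemma recursive_rat_abs [rec_intros]:
  assumes "recursive_rat F" shows "recursive_rat (\<lambda>A x. \<bar>F A x\<bar>)"
  using assms
proof (rule recursive_ratE)
  fix a b c assume *: "recursive a" "recursive b" "recursive c" "\<And>A x. c A x > 0"
    "\<And>A x. F A x = (real (a A x) - real (b A x)) / real (c A x)"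
  have 1: "recursive (\<lambda>A x. (a A x - b A x) + (b A x - a A x))" "recursive (\<lambda>A x. 0)"
    by (intro rec_intros *)+
  show ?thesis
  proof (rule recursive_ratI[OF 1 *(3,4)])
    fix A x
    show "\<bar>F A x\<bar> = (real (a A x - b A x + (b A x - a A x)) - real 0) / real (c A x)"
      using *(4)[of A x] by (cases "a A x \<le> b A x") (auto simp: *(5))
  qed
qed

lemma recursive_rat_if [rec_intros]:
  assumes "decidable P" "recursive_rat F" "recursive_rat G"
  shows "recursive_rat (\<lambda>A x. if P A x then F A x else G A x)"
proof -
  from assms(2,3) obtain a b c a' b' c' where r: "recursive a" "recursive b" "recursive c"
    "recursive a'" "recursive b'" "recursive c'"
    and *: "\<And>A x. c A x > 0" "\<And>A x. c' A x > 0"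
    "\<And>A x. F A x = (real (a A x) - real (b A x)) / real (c A x)"
    "\<And>A x. G A x = (real (a' A x) - real (b' A x)) / real (c' A x)"
    by (elim recursive_ratE) blast
  show ?thesis
    by (rule recursive_ratI[OF recursive_if[OF assms(1) r(1,4)] recursive_if[OF assms(1) r(2,5)]
          recursive_if[OF assms(1) r(3,6)]]) (auto simp: *)
qed

lemma recursive_rat_sum [rec_intros]:
  assumes "recursive_rat (\<lambda>A z. F A (pfst z) (psnd z))" "recursive m"
  shows "recursive_rat (\<lambda>A x. \<Sum>i<m A x. F A x i)"
proof -
  from assms(1) obtain a b c where r: "recursive a" "recursive b" "recursive c"
    and c: "\<And>A x. c A x > 0"
    and F: "\<And>A z. F A (pfst z) (psnd z) = (real (a A z) - real (b A z)) / real (c A z)"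
    by (elim recursive_ratE) blast
  note [rec_intros] = recursive_comp[OF r(1)] recursive_comp[OF r(2)] recursive_comp[OF r(3)]
  let ?c = "\<lambda>A x i. c A (prod_encode (x, i))"
  \<comment> \<open>The number of summands varies with the input, so one common denominator is
    formed: each \<open>?c A x i\<close> divides \<open>?D A x\<close>, and the numerators become
    naturals.\<close>
  let ?D = "\<lambda>A x. \<Prod>i<m A x. ?c A x i"
  have m': "recursive (\<lambda>A z. m A (pfst z))" by (rule recursive_comp[OF assms(2)]) (intro rec_intros)
  show ?thesis
  proof (rule recursive_ratI)
    show "recursive (\<lambda>A x. \<Sum>i<m A x. a A (prod_encode (x, i)) * (?D A x div ?c A x i))"
      "recursive (\<lambda>A x. \<Sum>i<m A x. b A (prod_encode (x, i)) * (?D A x div ?c A x i))"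
      "recursive ?D"
      by (intro rec_intros assms(2) m')+
    fix A x
    show D: "?D A x > 0" using c by (simp add: prod_pos)
    have 1: "real (?D A x div ?c A x i) = real (?D A x) / real (?c A x i)" if "i < m A x" for i
      by (rule real_of_nat_div) (use that in \<open>auto intro!: dvd_prodI\<close>)
    have 2: "F A x i = (real (a A (prod_encode (x, i))) - real (b A (prod_encode (x, i)))) / real (?c A x i)" for i
      using F[of A "prod_encode (x, i)"] by simp
    have "(\<Sum>i<m A x. F A x i) * real (?D A x) =
        real (\<Sum>i<m A x. a A (prod_encode (x, i)) * (?D A x div ?c A x i)) -
        real (\<Sum>i<m A x. b A (prod_encode (x, i)) * (?D A x div ?c A x i))"
      unfolding of_nat_sum sum_subtractf[symmetric] sum_distrib_right
    proof (rule sum.cong)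
      fix i assume "i \<in> {..<m A x}"
      then show "F A x i * real (?D A x) = real (a A (prod_encode (x, i)) * (?D A x div ?c A x i)) -
          real (b A (prod_encode (x, i)) * (?D A x div ?c A x i))"
        unfolding of_nat_mult using 1[of i] by (simp add: 2 algebra_simps diff_divide_distrib)
    qed simp
    with D show "(\<Sum>i<m A x. F A x i) = (real (\<Sum>i<m A x. a A (prod_encode (x, i)) * (?D A x div ?c A x i)) -
        real (\<Sum>i<m A x. b A (prod_encode (x, i)) * (?D A x div ?c A x i))) / real (?D A x)"
      by (metis nonzero_eq_divide_eq of_nat_0_less_iff order_less_irrefl)
  qed
qed

lemma decidable_rat_le [rec_intros]:
  assumes "recursive_rat F" "recursive_rat G"
  shows "decidable (\<lambda>A x. F A x \<le> G A x)"
proof -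
  from assms obtain a b c a' b' c' where [rec_intros]: "recursive a" "recursive b" "recursive c"
    "recursive a'" "recursive b'" "recursive c'"
    and *: "\<And>A x. c A x > 0" "\<And>A x. c' A x > 0"
    "\<And>A x. F A x = (real (a A x) - real (b A x)) / real (c A x)"
    "\<And>A x. G A x = (real (a' A x) - real (b' A x)) / real (c' A x)"
    by (elim recursive_ratE) blast
  have "decidable (\<lambda>A x. a A x * c' A x + b' A x * c A x \<le> a' A x * c A x + b A x * c' A x)"
    by (intro rec_intros)
  moreover have "F A x \<le> G A x \<longleftrightarrow> a A x * c' A x + b' A x * c A x \<le> a' A x * c A x + b A x * c' A x" for A x
  proof -
    have "F A x \<le> G A x \<longleftrightarrow> (real (a A x) - real (b A x)) * real (c' A x)
        \<le> (real (a' A x) - real (b' A x)) * real (c A x)"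
      using *(1,2)[of A x] by (simp add: *(3,4) frac_le_eq divide_le_eq pos_le_divide_eq field_simps)
    also have "\<dots> \<longleftrightarrow> real (a A x * c' A x + b' A x * c A x) \<le> real (a' A x * c A x + b A x * c' A x)"
      by (simp add: algebra_simps)
    finally show ?thesis unfolding of_nat_le_iff .
  qed
  ultimately show ?thesis by simp
qed

lemma decidable_rat_less [rec_intros]:
  assumes "recursive_rat F" "recursive_rat G"
  shows "decidable (\<lambda>A x. F A x < G A x)"
  using decidable_not[OF decidable_rat_le[OF assms(2,1)]] by (simp add: not_le)

lemma nat_to_rat_surj_prod_encode:
  "nat_to_rat_surj (prod_encode (u, v)) = Fract (int_decode u) (int_decode v)"
  by (simp add: nat_to_rat_surj_def)

lemma recursive_rat_code:
  assumes "recursive_rat F"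
  shows "\<exists>r. recursive r \<and> (\<forall>A x. of_rat (nat_to_rat_surj (r A x)) = F A x)"
  using assms
proof (rule recursive_ratE)
  fix a b c assume *: "recursive a" "recursive b" "recursive c" "\<And>A x. c A x > 0"
    "\<And>A x. F A x = (real (a A x) - real (b A x)) / real (c A x)"
  \<comment> \<open>\<open>int_decode\<close> sends \<open>2 * n\<close> to \<open>n\<close> and,
    for positive \<open>n\<close>, \<open>2 * n - 1\<close> to \<open>- n\<close>.\<close>
  let ?r = "\<lambda>A x. prod_encode (if b A x \<le> a A x then 2 * (a A x - b A x) else 2 * (b A x - a A x) - 1, 2 * c A x)"
  have "recursive ?r" by (intro rec_intros *)
  moreover have "of_rat (nat_to_rat_surj (?r A x)) = F A x" for A x
  proof -
    have 1: "int_decode (2 * n) = int n" for n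
      by (simp add: int_decode_def sum_decode_def)
    have 2: "int_decode (2 * n - 1) = - int n" if "n > 0" for n
    proof -
      from that obtain k where "n = Suc k" by (cases n) auto
      then show ?thesis by (simp add: int_decode_def sum_decode_def)
    qed
    have 3: "int_decode (if b A x \<le> a A x then 2 * (a A x - b A x) else 2 * (b A x - a A x) - 1)
        = int (a A x) - int (b A x)"
      by (cases "b A x \<le> a A x") (auto simp: 1 2 simp del: One_nat_def)
    show ?thesis using *(4)[of A x]
      unfolding nat_to_rat_surj_prod_encode 3 1 by (simp add: of_rat_rat *(5))
  qed
  ultimately show ?thesis by blast
qed

subsection \<open>Finite bit strings\<close>

text \<open>Bit \<open>m\<close> of the number is entry \<open>m\<close> of the point. A prefix of
  length \<open>L\<close> is thus a number below \<open>2 ^ L\<close>, prefixes are shortened by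
  \<open>take_bit\<close>, and integrals become sums over \<open>s < 2 ^ L\<close>.\<close>

definition code :: "nat \<Rightarrow> cantor \<Rightarrow> nat" where
  "code L x = horner_sum of_bool 2 (map x [0..<L])"

lemma bit_code [simp]: "bit (code L x) m \<longleftrightarrow> m < L \<and> x m"
  by (auto simp: code_def bit_horner_sum_bit_iff)

lemma code_less: "code L x < 2 ^ L"
proof -
  have "take_bit L (code L x) = code L x" by (rule bit_eqI) (auto simp: bit_take_bit_iff)
  then show ?thesis using take_bit_nat_less_exp[of L "code L x"] by simp
qed

lemma code_eqI: "(\<And>m. m < L \<Longrightarrow> x m = y m) \<Longrightarrow> code L x = code L y"
  by (rule bit_eqI) auto

lemma code_eq_iff:
  assumes "s < 2 ^ L" shows "code L x = s \<longleftrightarrow> (\<forall>m<L. x m = bit s m)"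
proof
  assume "code L x = s"
  then show "\<forall>m<L. x m = bit s m" using bit_code by blast
next
  assume *: "\<forall>m<L. x m = bit s m"
  have "code L x = take_bit L s"
    by (rule bit_eqI) (use * in \<open>auto simp: bit_take_bit_iff\<close>)
  then show "code L x = s" using assms by (simp add: take_bit_nat_eq_self_iff)
qed

lemma take_bit_code: "L \<le> L' \<Longrightarrow> take_bit L (code L' x) = code L x"
  by (rule bit_eqI) (auto simp: bit_take_bit_iff)

lemma recursive_code [rec_intros]:
  assumes "decidable (\<lambda>A z. x A (pfst z) (psnd z))" "recursive L"
  shows "recursive (\<lambda>A z. code (L A z) (x A z))"
proof -
  have "recursive (\<lambda>A z. \<Sum>m<L A z. of_bool (x A z m) * 2 ^ m)"
    by (intro rec_intros assms)
  then show ?thesis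
    by (rule recursive_cong) (simp add: code_def horner_sum_eq_sum atLeast0LessThan)
qed

lemma recursive_list_encode_upt [rec_intros]:
  assumes "recursive (\<lambda>A z. f A (pfst z) (psnd z))" "recursive L"
  shows "recursive (\<lambda>A x. list_encode (map (f A x) [0..<L A x]))"
proof -
  note [rec_intros] = recursive_comp2[OF assms(1)] recursive_comp[OF assms(2)]
  \<comment> \<open>\<open>list_encode\<close> wraps the head last, so the recursion runs from the
    last entry back to the first.\<close>
  have 1: "recursive (\<lambda>A x. rec_nat 0 (\<lambda>j r. Suc (prod_encode (f A x (L A x - Suc j), r))) (L A x))"
    by (intro rec_intros)
  have *: "rec_nat 0 (\<lambda>j r. Suc (prod_encode (h (l - Suc j), r))) n = list_encode (map h [l - n..<l])"
    if "n \<le> l" for h l n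
    using that
  proof (induction n)
    case (Suc n)
    then have "l - Suc n < l" "Suc (l - Suc n) = l - n" by auto
    then have "[l - Suc n..<l] = (l - Suc n) # [l - n..<l]" using upt_conv_Cons by metis
    with Suc show ?case by simp
  qed simp
  show ?thesis by (rule recursive_cong[OF 1]) (subst *, simp_all)
qed

subsection \<open>Bounded simulation of oracle programs\<close>

text \<open>Both the oracle and the result use \<open>0\<close> for ``undefined'' and \<open>Suc y\<close> for the value \<open>y\<close>.\<close>

primrec sim :: "(nat \<Rightarrow> nat) \<Rightarrow> nat \<Rightarrow> prog \<Rightarrow> nat \<Rightarrow> nat" where
  "sim Q t ZeroP x = 1"
| "sim Q t SuccP x = Suc (Suc x)"
| "sim Q t FstP x = Suc (pfst x)"
| "sim Q t SndP x = Suc (psnd x)"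
| "sim Q t OracleP x = Q x"
| "sim Q t (PairP f g) x =
     (if sim Q t f x = 0 then 0 else if sim Q t g x = 0 then 0
      else Suc (prod_encode (sim Q t f x - 1, sim Q t g x - 1)))"
| "sim Q t (CompP f g) x = (if sim Q t g x = 0 then 0 else sim Q t f (sim Q t g x - 1))"
| "sim Q t (PrecP f g) x =
     rec_nat (sim Q t f (pfst x))
       (\<lambda>m r. if r = 0 then 0 else sim Q t g (prod_encode (pfst x, prod_encode (m, r - 1))))
       (psnd x)"
| "sim Q t (MuP f) x =
     (\<Sum>n<t. if sim Q t f (prod_encode (x, n)) = 1 \<and> (\<forall>m<n. 1 < sim Q t f (prod_encode (x, m)))
            then Suc n else 0)"

text \<open>Induction on \<open>p\<close> gives one recursive function for each fixed program, so no
  universal machine is needed. It works because \<open>t\<close> bounds the search of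
  \<open>MuP\<close>, the only source of divergence. Oracle parameter, time and input are packed
  into one code.\<close>

lemma recursive_sim_aux:
  assumes "recursive (\<lambda>A z. Q A (pfst z) (psnd z))"
  shows "recursive (\<lambda>A z. sim (Q A (pfst (pfst z))) (psnd (pfst z)) p (psnd z))"
proof (induction p)
  case OracleP
  show ?case by (simp) (intro rec_intros recursive_comp2[OF assms])
next
  case (PairP p1 p2)
  note [rec_intros] = recursive_comp2[OF PairP(1)] recursive_comp2[OF PairP(2)]
  show ?case by simp (intro rec_intros PairP)
next
  case (CompP p1 p2)
  have "recursive (\<lambda>A z. sim (Q A (pfst (pfst z))) (psnd (pfst z)) p1
      (sim (Q A (pfst (pfst z))) (psnd (pfst z)) p2 (psnd z) - 1))"
    using recursive_comp2[where h = "\<lambda>A e x. sim (Q A (pfst e)) (psnd e) p1 x", OF CompP(1),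
        of "\<lambda>A. pfst" "\<lambda>A z. sim (Q A (pfst (pfst z))) (psnd (pfst z)) p2 (psnd z) - 1"]
    by (simp add: rec_intros CompP del: One_nat_def)
  then show ?case unfolding sim.simps by (intro rec_intros CompP)
next
  case (PrecP p1 p2)
  have 1: "recursive f \<Longrightarrow> recursive e \<Longrightarrow> recursive (\<lambda>A z. sim (Q A (pfst (e A z))) (psnd (e A z)) p1 (f A z))"
    for f e by (rule recursive_comp2[OF PrecP(1)])
  have 2: "recursive f \<Longrightarrow> recursive e \<Longrightarrow> recursive (\<lambda>A z. sim (Q A (pfst (e A z))) (psnd (e A z)) p2 (f A z))"
    for f e by (rule recursive_comp2[OF PrecP(2)])
  show ?case by simp (intro rec_intros 1 2)
next
  case (MuP p)
  have 1: "recursive f \<Longrightarrow> recursive e \<Longrightarrow> recursive (\<lambda>A z. sim (Q A (pfst (e A z))) (psnd (e A z)) p (f A z))"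
    for f e by (rule recursive_comp2[OF MuP])
  show ?case by simp (intro rec_intros 1)
qed (simp, intro rec_intros)+

lemma recursive_sim:
  assumes "recursive (\<lambda>A z. Q A (pfst z) (psnd z))" "recursive t" "recursive x"
  shows "recursive (\<lambda>A z. sim (Q A z) (t A z) p (x A z))"
proof -
  have "recursive (\<lambda>A z. prod_encode (z, t A z))" by (intro rec_intros assms)
  from recursive_comp2[where h = "\<lambda>A e x. sim (Q A (pfst e)) (psnd e) p x",
      OF recursive_sim_aux[OF assms(1)] this assms(3)]
  show ?thesis by simp
qed

text \<open>In the \<open>MuP\<close> clause of \<open>sim\<close> at most one index passes the
  test, so the sum acts as a bounded search that returns the shifted witness, or \<open>0\<close> if
  there is none.\<close>

lemma sum_at_most_one_nonzero:
  fixes P :: "nat \<Rightarrow> bool"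
  assumes "\<And>m n. P m \<Longrightarrow> P n \<Longrightarrow> m = n"
  shows "(\<Sum>n<t. if P n then Suc n else 0) = Suc y \<longleftrightarrow> y < t \<and> P y"
proof (cases "\<exists>n<t. P n")
  case True
  then obtain n where n: "n < t" "P n" by blast
  have P: "P k \<longleftrightarrow> k = n" for k using assms[of k n] n(2) by blast
  from n(1) show ?thesis unfolding P by auto
next
  case False
  then have "(\<Sum>n<t. if P n then Suc n else 0) = 0" by auto
  with False show ?thesis by auto
qed

text \<open>In the shifted coding \<open>1\<close> is the value \<open>0\<close>, and larger numbers
  are nonzero values; demanding these at all smaller arguments makes the root unique.\<close>

lemma sim_MuP_iff:
  "sim Q t (MuP f) x = Suc y \<longleftrightarrow> y < t \<and> sim Q t f (prod_encode (x, y)) = 1 \<and>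
    (\<forall>m<y. 1 < sim Q t f (prod_encode (x, m)))"
  unfolding sim.simps
proof (rule sum_at_most_one_nonzero)
  fix m n
  assume "sim Q t f (prod_encode (x, m)) = 1 \<and> (\<forall>k<m. 1 < sim Q t f (prod_encode (x, k)))"
    "sim Q t f (prod_encode (x, n)) = 1 \<and> (\<forall>k<n. 1 < sim Q t f (prod_encode (x, k)))"
  then show "m = n" by (cases m n rule: linorder_cases) force+
qed

text \<open>The definition returns the least root but asks for definedness below some root. It then
  holds below the least one, where the values are also nonzero.\<close>

lemma run_MuP_iff:
  "run A (MuP f) x = Some y \<longleftrightarrow> run A f (prod_encode (x, y)) = Some 0 \<and>
    (\<forall>m<y. \<exists>v. run A f (prod_encode (x, m)) = Some (Suc v))" (is "_ \<longleftrightarrow> ?R y")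
proof
  let ?P = "\<lambda>n. run A f (prod_encode (x, n)) = Some 0"
  assume "run A (MuP f) x = Some y"
  then obtain n where n: "?P n" "\<forall>m<n. run A f (prod_encode (x, m)) \<noteq> None" and y: "y = (LEAST n. ?P n)"
    by (auto split: if_splits)
  have "?P y" unfolding y using n(1) by (rule LeastI)
  moreover have "\<exists>v. run A f (prod_encode (x, m)) = Some (Suc v)" if m: "m < y" for m
  proof -
    have "y \<le> n" unfolding y using n(1) by (rule Least_le)
    with m n(2) obtain v where "run A f (prod_encode (x, m)) = Some v" by fastforce
    moreover have "\<not> ?P m" using m unfolding y by (rule not_less_Least)
    ultimately show ?thesis by (cases v) auto
  qed
  ultimately show "?R y" by blast
next
  let ?P = "\<lambda>n. run A f (prod_encode (x, n)) = Some 0"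
  assume R: "?R y"
  have "(LEAST n. ?P n) = y"
  proof (rule Least_equality)
    fix n assume "?P n"
    show "y \<le> n"
    proof (rule ccontr)
      assume "\<not> y \<le> n"
      with R obtain v where "run A f (prod_encode (x, n)) = Some (Suc v)" by (meson not_le)
      with \<open>?P n\<close> show False by simp
    qed
  qed (use R in blast)
  moreover have "\<exists>n. ?P n \<and> (\<forall>m<n. run A f (prod_encode (x, m)) \<noteq> None)"
    using R by (intro exI[of _ y]) fastforce
  ultimately show "run A (MuP f) x = Some y" by simp
qed

lemma run_PrecP:
  "run A (PrecP f g) (prod_encode (x, 0)) = run A f x"
  "run A (PrecP f g) (prod_encode (x, Suc n)) =
     Option.bind (run A (PrecP f g) (prod_encode (x, n))) (\<lambda>y. run A g (prod_encode (x, prod_encode (n, y))))"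
  by simp_all

lemma sim_PrecP:
  "sim Q t (PrecP f g) (prod_encode (x, 0)) = sim Q t f x"
  "sim Q t (PrecP f g) (prod_encode (x, Suc n)) =
     (if sim Q t (PrecP f g) (prod_encode (x, n)) = 0 then 0
      else sim Q t g (prod_encode (x, prod_encode (n, sim Q t (PrecP f g) (prod_encode (x, n)) - 1))))"
  unfolding sim.simps pfst_prod_encode psnd_prod_encode by simp_all

text \<open>The use principle: \<open>Q\<close> records a part of \<open>A\<close>, and an answer
  obtained from this part is the answer for \<open>A\<close> itself.\<close>

lemma sim_sound:
  assumes "\<And>m y. Q m = Suc y \<Longrightarrow> A m = y"
  shows "sim Q t p x = Suc y \<Longrightarrow> run A p x = Some y"
proof (induction p arbitrary: x y)
  case (PrecP f g)
  have "sim Q t (PrecP f g) (prod_encode (u, n)) = Suc y \<Longrightarrow> run A (PrecP f g) (prod_encode (u, n)) = Some y"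
    for u n y
  proof (induction n arbitrary: y)
    case 0
    then show ?case unfolding run_PrecP sim_PrecP by (rule PrecP(1))
  next
    case (Suc n)
    from Suc.prems obtain r where r: "sim Q t (PrecP f g) (prod_encode (u, n)) = Suc r"
      unfolding sim_PrecP by (cases "sim Q t (PrecP f g) (prod_encode (u, n)) = 0") (auto simp: gr0_conv_Suc simp del: sim.simps)
    with Suc.prems have "sim Q t g (prod_encode (u, prod_encode (n, r))) = Suc y"
      unfolding sim_PrecP by simp
    from PrecP(2)[OF this] Suc.IH[OF r] show ?case unfolding run_PrecP by simp
  qed
  from this[of "pfst x" "psnd x"] PrecP.prems show ?case by (simp only: prod_encode_pfst_psnd)
next
  case (MuP f)
  have **: "\<exists>v. k = Suc (Suc v)" if "1 < k" for k :: nat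
    using that by (intro exI[of _ "k - 2"]) simp
  from MuP.prems have "sim Q t f (prod_encode (x, y)) = Suc 0"
      "\<forall>m<y. \<exists>v. sim Q t f (prod_encode (x, m)) = Suc (Suc v)"
    unfolding sim_MuP_iff using ** by simp_all
  with MuP.IH show ?case unfolding run_MuP_iff by blast
next
  case (CompP f g)
  then obtain z where "sim Q t g x = Suc z" by (cases "sim Q t g x") auto
  with CompP show ?case by simp
next
  case (PairP f g)
  then obtain z z' where "sim Q t f x = Suc z" "sim Q t g x = Suc z'"
    by (cases "sim Q t f x"; cases "sim Q t g x") auto
  with PairP show ?case by simp
qed (auto simp: pfst_def psnd_def assms)

text \<open>Answers are never revised when more of the oracle is known or more time is allowed; this
  is why sets of undecided points decrease.\<close>

lemma sim_mono:
  assumes "\<And>m y. Q m = Suc y \<Longrightarrow> Q' m = Suc y" "t \<le> t'"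
  shows "sim Q t p x = Suc y \<Longrightarrow> sim Q' t' p x = Suc y"
proof (induction p arbitrary: x y)
  case (PrecP f g)
  have "sim Q t (PrecP f g) (prod_encode (u, n)) = Suc y \<Longrightarrow> sim Q' t' (PrecP f g) (prod_encode (u, n)) = Suc y"
    for u n y
  proof (induction n arbitrary: y)
    case 0
    then show ?case unfolding sim_PrecP by (rule PrecP(1))
  next
    case (Suc n)
    from Suc.prems obtain r where r: "sim Q t (PrecP f g) (prod_encode (u, n)) = Suc r"
      unfolding sim_PrecP by (cases "sim Q t (PrecP f g) (prod_encode (u, n)) = 0") (auto simp: gr0_conv_Suc simp del: sim.simps)
    with Suc.prems have "sim Q t g (prod_encode (u, prod_encode (n, r))) = Suc y"
      unfolding sim_PrecP by simp
    from PrecP(2)[OF this] Suc.IH[OF r] show ?case unfolding sim_PrecP by simp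
  qed
  from this[of "pfst x" "psnd x"] PrecP.prems show ?case by (simp only: prod_encode_pfst_psnd)
next
  case (MuP f)
  have 1: "1 < sim Q' t' f z" if "1 < sim Q t f z" for z
  proof -
    from that obtain v where "sim Q t f z = Suc v" "0 < v" by (cases "sim Q t f z") auto
    with MuP.IH[of z v] show ?thesis by simp
  qed
  from MuP.prems show ?case unfolding sim_MuP_iff using 1 MuP.IH[of "prod_encode (x, y)" 0] assms(2) by simp
next
  case (CompP f g)
  then obtain z where "sim Q t g x = Suc z" by (cases "sim Q t g x") auto
  with CompP show ?case by simp
next
  case (PairP f g)
  then obtain z z' where "sim Q t f x = Suc z" "sim Q t g x = Suc z'"
    by (cases "sim Q t f x"; cases "sim Q t g x") auto
  with PairP show ?case by simp
qed (auto simp: assms)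

text \<open>A halting run asks finitely many questions and makes finitely many searches, so one late
  stage serves all of them.\<close>

lemma sim_complete:
  assumes "\<And>t t' m y. t \<le> t' \<Longrightarrow> Q t m = Suc y \<Longrightarrow> Q t' m = Suc y" "\<And>m. \<exists>t. Q t m = Suc (A m)"
  shows "run A p x = Some y \<Longrightarrow> \<exists>t. sim (Q t) t p x = Suc y"
proof (induction p arbitrary: x y)
  have mono: "sim (Q t') t' p x = Suc y" if "sim (Q t) t p x = Suc y" "t \<le> t'" for t t' p x y
    using sim_mono[of "Q t" "Q t'"] assms(1) that by blast
  {
    case (PrecP f g)
    have "run A (PrecP f g) (prod_encode (u, n)) = Some y \<Longrightarrow> \<exists>t. sim (Q t) t (PrecP f g) (prod_encode (u, n)) = Suc y"
      for u n y
    proof (induction n arbitrary: y)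
      case 0
      then show ?case unfolding run_PrecP sim_PrecP by (rule PrecP(1))
    next
      case (Suc n)
      from Suc.prems obtain r where r: "run A (PrecP f g) (prod_encode (u, n)) = Some r"
        "run A g (prod_encode (u, prod_encode (n, r))) = Some y"
        unfolding run_PrecP by (auto simp: bind_eq_Some_conv)
      from Suc.IH[OF r(1)] PrecP(2)[OF r(2)] obtain t1 t2 where
        t: "sim (Q t1) t1 (PrecP f g) (prod_encode (u, n)) = Suc r"
        "sim (Q t2) t2 g (prod_encode (u, prod_encode (n, r))) = Suc y" by blast
      from mono[OF t(1), of "max t1 t2"] mono[OF t(2), of "max t1 t2"]
      have "sim (Q (max t1 t2)) (max t1 t2) (PrecP f g) (prod_encode (u, Suc n)) = Suc y"
        unfolding sim_PrecP by simp
      then show ?case by blast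
    qed
    from this[of "pfst x" "psnd x"] PrecP.prems show ?case by (simp only: prod_encode_pfst_psnd)
  next
    case (MuP f)
    from MuP.prems have *: "run A f (prod_encode (x, y)) = Some 0"
      "\<forall>m<y. \<exists>v. run A f (prod_encode (x, m)) = Some (Suc v)"
      unfolding run_MuP_iff by auto
    from MuP.IH[OF *(1)] obtain t0 where t0: "sim (Q t0) t0 f (prod_encode (x, y)) = Suc 0" by blast
    have "\<forall>m. \<exists>t. m < y \<longrightarrow> 1 < sim (Q t) t f (prod_encode (x, m))"
    proof
      fix m show "\<exists>t. m < y \<longrightarrow> 1 < sim (Q t) t f (prod_encode (x, m))"
      proof (cases "m < y")
        case True
        with *(2) obtain v where "run A f (prod_encode (x, m)) = Some (Suc v)" by blast
        from MuP.IH[OF this] obtain t where "sim (Q t) t f (prod_encode (x, m)) = Suc (Suc v)" by blast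
        then show ?thesis by (intro exI[of _ t]) simp
      qed simp
    qed
    then obtain T where T: "\<And>m. m < y \<Longrightarrow> 1 < sim (Q (T m)) (T m) f (prod_encode (x, m))" by metis
    \<comment> \<open>\<open>Suc y\<close> puts the root \<open>y\<close> inside the search range,
      \<open>t0\<close> settles the value there, and the sum is at least every stage needed below
      \<open>y\<close>.\<close>
    define t where "t = Suc y + t0 + sum T {..<y}"
    have "1 < sim (Q t) t f (prod_encode (x, m))" if "m < y" for m
    proof -
      from T[OF that] obtain v where v: "sim (Q (T m)) (T m) f (prod_encode (x, m)) = Suc v" "v > 0"
        by (cases "sim (Q (T m)) (T m) f (prod_encode (x, m))") auto
      have "T m \<le> sum T {..<y}" using that by (intro member_le_sum) auto
      then have "T m \<le> t" by (simp add: t_def)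
      from mono[OF v(1) this] v(2) show ?thesis by simp
    qed
    moreover have "sim (Q t) t f (prod_encode (x, y)) = Suc 0"
      by (rule mono[OF t0]) (simp add: t_def)
    ultimately have "sim (Q t) t (MuP f) x = Suc y" unfolding sim_MuP_iff by (simp add: t_def)
    then show ?case by blast
  next
    case (CompP f g)
    then obtain z where z: "run A g x = Some z" "run A f z = Some y" by (auto simp: bind_eq_Some_conv)
    from CompP(2)[OF z(1)] CompP(1)[OF z(2)] obtain t1 t2 where
      t: "sim (Q t1) t1 g x = Suc z" "sim (Q t2) t2 f z = Suc y" by blast
    from mono[OF t(1), of "max t1 t2"] mono[OF t(2), of "max t1 t2"]
    have "sim (Q (max t1 t2)) (max t1 t2) (CompP f g) x = Suc y" by simp
    then show ?case by blast
  next
    case (PairP f g)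
    then obtain z z' where z: "run A f x = Some z" "run A g x = Some z'" "y = prod_encode (z, z')"
      by (auto simp: bind_eq_Some_conv)
    from PairP(1)[OF z(1)] PairP(2)[OF z(2)] obtain t1 t2 where
      t: "sim (Q t1) t1 f x = Suc z" "sim (Q t2) t2 g x = Suc z'" by blast
    from mono[OF t(1), of "max t1 t2"] mono[OF t(2), of "max t1 t2"]
    have "sim (Q (max t1 t2)) (max t1 t2) (PairP f g) x = Suc y" by (simp add: z)
    then show ?case by blast
  }
qed (auto simp: pfst_def psnd_def assms(2))

subsection \<open>Fair bits\<close>

text \<open>Two instances are needed: Cantor space itself, where Schnorr tests live, and sequences
  read through \<open>join\<close>, where martingales live. Prefix probabilities determine the
  integral of every function of \<open>code L\<close>.\<close>

locale fair_bits = prob_space N for N :: "'a measure" +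
  fixes X :: "'a \<Rightarrow> cantor"
  assumes space_eq [simp]: "space N = UNIV"
    and sets_bit: "\<And>m. {\<omega>. X \<omega> m} \<in> sets N"
    and prob_prefix: "\<And>L c. measure N {\<omega>. \<forall>m<L. X \<omega> m = c m} = 1 / 2 ^ L"
begin

lemma sets_code_eq: "{\<omega>. code L (X \<omega>) = s} \<in> sets N"
proof (cases "s < 2 ^ L")
  case True
  have "{\<omega>. X \<omega> m = b} \<in> sets N" for m b
  proof (cases b)
    case True
    then show ?thesis using sets_bit by simp
  next
    case False
    have "{\<omega>. X \<omega> m = b} = space N - {\<omega>. X \<omega> m}" using False by auto
    then show ?thesis using sets_bit by (simp only: sets.compl_sets)
  qed
  then have "{\<omega> \<in> space N. \<forall>m\<in>{..<L}. X \<omega> m = bit s m} \<in> sets N"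
    by (intro sets.sets_Collect_finite_All) auto
  with True show ?thesis by (simp add: code_eq_iff Ball_def)
next
  case False
  then have "{\<omega>. code L (X \<omega>) = s} = {}" using code_less by auto
  then show ?thesis by simp
qed

lemma measurable_code [measurable]: "(\<lambda>\<omega>. code L (X \<omega>)) \<in> N \<rightarrow>\<^sub>M count_space UNIV"
  using sets_code_eq by (auto simp: measurable_count_space_eq2_countable vimage_def)

lemma prob_code_eq: "s < 2 ^ L \<Longrightarrow> measure N {\<omega>. code L (X \<omega>) = s} = 1 / 2 ^ L"
  by (simp add: code_eq_iff prob_prefix)

lemma code_expand:
  fixes f :: "nat \<Rightarrow> real"
  shows "f (code L (X \<omega>)) = (\<Sum>s<2 ^ L. f s * indicator {\<omega>. code L (X \<omega>) = s} \<omega>)"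
proof -
  have "(\<Sum>s<2 ^ L. f s * indicator {\<omega>. code L (X \<omega>) = s} \<omega>) = (\<Sum>s<2 ^ L. if s = code L (X \<omega>) then f s else 0)"
    by (intro sum.cong) (auto simp: indicator_def)
  also have "\<dots> = f (code L (X \<omega>))" using code_less[of L "X \<omega>"] by simp
  finally show ?thesis by simp
qed

lemma integrable_code [simp, intro]:
  fixes f :: "nat \<Rightarrow> real"
  shows "integrable N (\<lambda>\<omega>. f (code L (X \<omega>)))"
  unfolding code_expand[of f] by (intro Bochner_Integration.integrable_sum integrable_mult_right)
    (use sets_code_eq in \<open>auto simp: less_top[symmetric]\<close>)

lemma integral_code:
  fixes f :: "nat \<Rightarrow> real"
  shows "(\<integral>\<omega>. f (code L (X \<omega>)) \<partial>N) = (\<Sum>s<2 ^ L. f s) / 2 ^ L"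
proof -
  have "(\<integral>\<omega>. f (code L (X \<omega>)) \<partial>N) = (\<Sum>s<2 ^ L. \<integral>\<omega>. f s * indicator {\<omega>. code L (X \<omega>) = s} \<omega> \<partial>N)"
    unfolding code_expand[of f] by (intro Bochner_Integration.integral_sum integrable_mult_right)
      (use sets_code_eq in \<open>auto simp: less_top[symmetric]\<close>)
  also have "\<dots> = (\<Sum>s<2 ^ L. f s * (1 / 2 ^ L))"
    using sets_code_eq by (intro sum.cong) (simp_all add: prob_code_eq)
  finally show ?thesis by (simp add: sum_divide_distrib)
qed

lemma prob_code: "measure N {\<omega>. P (code L (X \<omega>))} = real (\<Sum>s<2 ^ L. of_bool (P s)) / 2 ^ L"
proof -
  have m: "{\<omega>. P (code L (X \<omega>))} \<in> sets N"
    using measurable_sets[OF measurable_code, of "{s. P s}"] by (simp add: vimage_def)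
  have "measure N {\<omega>. P (code L (X \<omega>))} = (\<integral>\<omega>. indicator {\<omega>. P (code L (X \<omega>))} \<omega> \<partial>N)"
    using m by simp
  also have "\<dots> = (\<integral>\<omega>. of_bool (P (code L (X \<omega>))) \<partial>N)"
    by (intro Bochner_Integration.integral_cong) (auto simp: indicator_def)
  also have "\<dots> = (\<Sum>s<2 ^ L. of_bool (P s)) / 2 ^ L"
    by (rule integral_code)
  finally show ?thesis by simp
qed

lemma sets_code [measurable]: "{\<omega>. P (code L (X \<omega>))} \<in> sets N"
  using measurable_sets[OF measurable_code, of "{s. P s}"] by (simp add: vimage_def)

end

section \<open>The coin measures on Cantor space and on its sequences\<close>

lemma space_cantor_measure [simp]: "space cantor_measure = UNIV"
  by (simp add: cantor_measure_def space_PiM)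

lemma space_seq_measure [simp]: "space seq_measure = UNIV"
  by (simp add: seq_measure_def space_PiM)

interpretation coins: product_prob_space "\<lambda>_::nat. measure_pmf (bernoulli_pmf (1/2))" UNIV
  by unfold_locales

interpretation cantor: prob_space cantor_measure
  unfolding cantor_measure_def by (rule coins.P.prob_space_axioms)

interpretation cseq: sequence_space cantor_measure
  by unfold_locales

interpretation seq: prob_space seq_measure
  unfolding seq_measure_def by (rule cseq.P.prob_space_axioms)

lemma cantor_cylinder:
  assumes "finite J"
  shows "{x. \<forall>b\<in>J. x b = c b} \<in> sets cantor_measure"
    and "measure cantor_measure {x. \<forall>b\<in>J. x b = c b} = (1/2) ^ card J"
proof -
  let ?M = "\<lambda>_::nat. measure_pmf (bernoulli_pmf (1/2))"
  have eq: "{x. \<forall>b\<in>J. x b = c b} = prod_emb UNIV ?M J (Pi\<^sub>E J (\<lambda>b. {c b}))"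
    by (auto simp: prod_emb_def PiE_def Pi_def)
  show "{x. \<forall>b\<in>J. x b = c b} \<in> sets cantor_measure"
    unfolding eq cantor_measure_def using assms by (intro sets_PiM_I) auto
  have "measure cantor_measure {x. \<forall>b\<in>J. x b = c b} = (\<Prod>b\<in>J. measure (?M b) {c b})"
    unfolding eq cantor_measure_def using assms by (intro coins.measure_PiM_emb) auto
  also have "\<dots> = (\<Prod>b\<in>J. 1/2)"
    by (intro prod.cong refl) (simp add: measure_pmf_single pmf_bernoulli_half)
  finally show "measure cantor_measure {x. \<forall>b\<in>J. x b = c b} = (1/2) ^ card J" by simp
qed

lemma prod_encode_mono: "a \<le> a' \<Longrightarrow> prod_encode (a, b) \<le> prod_encode (a', b)"
  by (simp add: prod_encode_def triangle_def div_le_mono mult_le_mono add_le_mono)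

text \<open>A prefix of length \<open>L\<close> of the join fixes in row \<open>a\<close> the bits
  \<open>b\<close> with \<open>prod_encode (a, b) < L\<close>. Rows are independent, and since
  pairing is a bijection exactly \<open>L\<close> bits are fixed altogether.\<close>

lemma join_prefix:
  shows "{\<omega>. \<forall>m<L. join \<omega> m = c m} \<in> sets seq_measure"
    and "measure seq_measure {\<omega>. \<forall>m<L. join \<omega> m = c m} = 1 / 2 ^ L"
proof -
  let ?I = "pfst ` {..<L}"
  let ?B = "\<lambda>a. {b. prod_encode (a, b) < L}"
  let ?C = "\<lambda>a. {x :: cantor. \<forall>b\<in>?B a. x b = c (prod_encode (a, b))}"
  have fin: "finite (?B a)" for a
    by (rule finite_subset[of _ "{..L}"]) (auto intro: order.trans[OF le_prod_encode_2] less_imp_le)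
  have eq: "{\<omega>. \<forall>m<L. join \<omega> m = c m} = prod_emb UNIV (\<lambda>_. cantor_measure) ?I (Pi\<^sub>E ?I ?C)"
  proof (intro set_eqI iffI)
    fix \<omega> :: "nat \<Rightarrow> cantor"
    assume *: "\<omega> \<in> {\<omega>. \<forall>m<L. join \<omega> m = c m}"
    have "\<omega> a \<in> ?C a" for a
    proof (intro CollectI ballI)
      fix b assume "b \<in> ?B a"
      with * show "\<omega> a b = c (prod_encode (a, b))" by (auto simp: join_def dest!: spec[of _ "prod_encode (a, b)"])
    qed
    then show "\<omega> \<in> prod_emb UNIV (\<lambda>_. cantor_measure) ?I (Pi\<^sub>E ?I ?C)"
      by (auto simp: prod_emb_def PiE_def Pi_def)
  next
    fix \<omega> :: "nat \<Rightarrow> cantor"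
    assume "\<omega> \<in> prod_emb UNIV (\<lambda>_. cantor_measure) ?I (Pi\<^sub>E ?I ?C)"
    then have *: "\<forall>a\<in>?I. \<omega> a \<in> ?C a" by (auto simp: prod_emb_def PiE_def Pi_def)
    show "\<omega> \<in> {\<omega>. \<forall>m<L. join \<omega> m = c m}"
    proof (intro CollectI allI impI)
      fix m assume "m < L"
      with * have "\<omega> (pfst m) \<in> ?C (pfst m)" by blast
      with \<open>m < L\<close> show "join \<omega> m = c m"
        by (auto simp: join_def pfst_def[symmetric] psnd_def[symmetric] dest!: spec[of _ "psnd m"])
    qed
  qed
  show "{\<omega>. \<forall>m<L. join \<omega> m = c m} \<in> sets seq_measure"
    unfolding eq seq_measure_def using cantor_cylinder(1)[OF fin] by (intro sets_PiM_I) auto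
  have "measure seq_measure {\<omega>. \<forall>m<L. join \<omega> m = c m} = (\<Prod>a\<in>?I. measure cantor_measure (?C a))"
    unfolding eq seq_measure_def using cantor_cylinder(1)[OF fin] by (intro cseq.measure_PiM_emb) auto
  also have "\<dots> = (\<Prod>a\<in>?I. (1/2) ^ card (?B a))"
    by (intro prod.cong refl cantor_cylinder(2)[OF fin])
  also have "\<dots> = (1/2) ^ (\<Sum>a\<in>?I. card (?B a))"
    by (simp add: power_sum)
  also have "(\<Sum>a\<in>?I. card (?B a)) = card (SIGMA a:?I. ?B a)"
    using fin by (intro card_SigmaI[symmetric]) auto
  also have "(SIGMA a:?I. ?B a) = prod_decode ` {..<L}"
  proof (intro set_eqI iffI)
    fix z assume z: "z \<in> (SIGMA a:?I. ?B a)"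
    have "z = prod_decode (prod_encode z)" by simp
    moreover have "prod_encode z < L" using z by auto
    ultimately show "z \<in> prod_decode ` {..<L}" by blast
  next
    fix z assume "z \<in> prod_decode ` {..<L}"
    then obtain m where "m < L" "z = prod_decode m" by blast
    then have "z = (pfst m, psnd m)" by (simp add: pfst_def psnd_def)
    with \<open>m < L\<close> show "z \<in> (SIGMA a:?I. ?B a)" by auto
  qed
  also have "card \<dots> = L" by (simp add: card_image inj_prod_decode)
  finally show "measure seq_measure {\<omega>. \<forall>m<L. join \<omega> m = c m} = 1 / 2 ^ L"
    by (simp add: power_one_over)
qed

interpretation cantor: fair_bits cantor_measure "\<lambda>x. x"
proof
  show "{x. x m} \<in> sets cantor_measure" for m
    using cantor_cylinder(1)[of "{m}" "\<lambda>_. True"] by simp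
  show "measure cantor_measure {x. \<forall>m<L. x m = c m} = 1 / 2 ^ L" for L c
    using cantor_cylinder(2)[of "{..<L}" c] by (simp add: Ball_def power_one_over)
qed simp

lemma sets_join: "{\<omega>. join \<omega> m} \<in> sets seq_measure"
proof -
  have "(\<lambda>\<omega>. \<omega> (pfst m)) \<in> seq_measure \<rightarrow>\<^sub>M cantor_measure"
    unfolding seq_measure_def by (rule measurable_component_singleton) simp
  from measurable_sets[OF this, of "{x. x (psnd m)}"] cantor.sets_bit[of "psnd m"]
  show ?thesis by (simp add: join_def vimage_def pfst_def psnd_def)
qed

interpretation seq: fair_bits seq_measure join
  by unfold_locales (auto simp: sets_join join_prefix)

text \<open>The code of \<open>(\<omega>\<^sub>0, \<dots>, \<omega>\<^sub>i\<^sub>-\<^sub>1, \<xi>\<^sub>0, \<xi>\<^sub>1, \<dots>)\<close> from the codes of \<open>\<omega>\<close> and \<open>\<xi>\<close>.\<close>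

definition splice :: "nat \<Rightarrow> nat \<Rightarrow> nat \<Rightarrow> nat \<Rightarrow> nat" where
  "splice i L s s' = code L (\<lambda>m. if pfst m < i then bit s m else bit s' (prod_encode (pfst m - i, psnd m)))"

lemma code_join_comb_seq:
  "code L (join (comb_seq i \<omega> \<xi>)) = splice i L (code L (join \<omega>)) (code L (join \<xi>))"
  unfolding splice_def
proof (rule code_eqI)
  fix m assume m: "m < L"
  \<comment> \<open>Lowering the row index does not raise the pair code, so \<open>L\<close> bits of
    \<open>\<xi>\<close> suffice.\<close>
  have "prod_encode (pfst m - i, psnd m) \<le> prod_encode (pfst m, psnd m)"
    by (rule prod_encode_mono) simp
  with m have "prod_encode (pfst m - i, psnd m) < L" by simp
  with m show "join (comb_seq i \<omega> \<xi>) m = (if pfst m < i then bit (code L (join \<omega>)) m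
      else bit (code L (join \<xi>)) (prod_encode (pfst m - i, psnd m)))"
    by (simp add: join_def comb_seq_def pfst_def psnd_def)
qed

text \<open>For a function of finitely many bits, integration over the tail is an average over its
  \<open>2 ^ L\<close> prefixes, so conditional expectations of rational step functions stay exactly
  computable.\<close>

lemma cond_exp_code:
  "cond_exp i (\<lambda>\<omega>. F (code L (join \<omega>))) \<omega> = (\<Sum>s'<2 ^ L. F (splice i L (code L (join \<omega>)) s')) / 2 ^ L"
  unfolding cond_exp_def code_join_comb_seq by (rule seq.integral_code)

lemma recursive_splice [rec_intros]:
  assumes "recursive i" "recursive L" "recursive s" "recursive s'"
  shows "recursive (\<lambda>A z. splice (i A z) (L A z) (s A z) (s' A z))"
  unfolding splice_def
  by (intro rec_intros assms recursive_comp[OF assms(1)] recursive_comp[OF assms(3)] recursive_comp[OF assms(4)])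

subsection \<open>Schnorr random points\<close>

lemma inj_list_encode_map_of_bool:
  "list_encode (map of_bool \<sigma>) = list_encode (map of_bool \<tau>) \<longleftrightarrow> \<sigma> = \<tau>"
proof
  assume "list_encode (map of_bool \<sigma>) = list_encode (map of_bool \<tau>)"
  then have "map of_bool \<sigma> = (map of_bool \<tau> :: nat list)" by (metis list_encode_inverse)
  then show "\<sigma> = \<tau>" by (rule map_injective) (auto simp: inj_def)
qed simp

lemma mem_cylinder_map: "x \<in> cylinder (map y [0..<L]) \<longleftrightarrow> (\<forall>m<L. x m = y m)"
  by (simp add: cylinder_def)

text \<open>The unions over \<open>n > k\<close> form a Schnorr test. Their measure is at most the
  tail of a geometric series, and it is computable because a finite part of the union is clopen, so
  its measure can be counted, while the remainder is again a tail of small measure.\<close>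

lemma schnorr_Borel_Cantelli:
  assumes schnorr: "schnorr_random \<omega>"
    and c: "decidable (\<lambda>A z. c (pfst z) (psnd z))" and L: "recursive (\<lambda>A. L)"
    and small: "\<And>n. real (\<Sum>s<2 ^ L n. of_bool (c n s)) / 2 ^ L n \<le> 1 / 2 ^ n"
  shows "\<exists>k. \<forall>n>k. \<not> c n (code (L n) (join \<omega>))"
proof (rule ccontr)
  note [rec_intros] = decidable_comp2[OF c] recursive_comp[OF L]
  let ?C = "\<lambda>n. {x. c n (code (L n) x)}"
  define V where "V k = {x. \<exists>n>k. c n (code (L n) x)}" for k
  have Cn: "measure cantor_measure (?C n) \<le> 1 / 2 ^ n" for n
    unfolding cantor.prob_code by (rule small)
  have V_sets: "V k \<in> sets cantor_measure" for k
  proof -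
    have "V k = (\<Union>n\<in>{k<..}. ?C n)" by (auto simp: V_def)
    then show ?thesis using cantor.sets_code by auto
  qed
  have V_le: "measure cantor_measure (V k) \<le> 1 / 2 ^ k" for k
  proof -
    have sums: "(\<lambda>i. (1/2) ^ (Suc k + i)) sums ((1/2::real) ^ k)"
      using sums_mult[OF power_half_series, of "(1/2) ^ k"] by (simp add: power_add mult_ac)
    have le: "measure cantor_measure (?C (Suc k + i)) \<le> (1/2) ^ (Suc k + i)" for i
      using Cn[of "Suc k + i"] by (simp add: power_one_over)
    have summ: "summable (\<lambda>i. measure cantor_measure (?C (Suc k + i)))"
      by (rule summable_comparison_test'[OF sums_summable[OF sums], of 0]) (use le in auto)
    have "V k = (\<Union>i. ?C (Suc k + i))"
      unfolding V_def less_iff_Suc_add by auto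
    then have "measure cantor_measure (V k) \<le> (\<Sum>i. measure cantor_measure (?C (Suc k + i)))"
      using summ by (simp only:) (intro cantor.finite_measure_subadditive_countably, auto)
    also have "\<dots> \<le> (\<Sum>i. (1/2) ^ (Suc k + i))"
      using le summ sums_summable[OF sums] by (intro suminf_le) auto
    also have "\<dots> = (1/2) ^ k" using sums by (simp add: sums_iff)
    finally show ?thesis by (simp add: power_one_over)
  qed
  have "effectively_open_seq V"
  proof -
    \<comment> \<open>The witness \<open>w\<close> codes a pair \<open>(n, s)\<close>; it lists the
      string of length \<open>L n\<close> whose code is \<open>s\<close>.\<close>
    let ?P = "\<lambda>z w. pfst z < pfst w \<and> psnd w < 2 ^ L (pfst w) \<and> c (pfst w) (psnd w) \<and>
        list_encode (map (\<lambda>m. of_bool (bit (psnd w) m)) [0..<L (pfst w)]) = psnd z"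
    have "decidable (\<lambda>A z. ?P (pfst z) (psnd z))" by (intro rec_intros)
    from semidecidable_domain[OF this] obtain p where p: "\<And>A z. run A p z \<noteq> None \<longleftrightarrow> (\<exists>w. ?P z w)" by blast
    have dom: "run no_oracle p (prod_encode (k, list_encode (map of_bool \<sigma>))) \<noteq> None \<longleftrightarrow>
        (\<exists>n>k. \<exists>s<2 ^ L n. c n s \<and> \<sigma> = map (bit s) [0..<L n])" for k \<sigma>
    proof -
      have "list_encode (map (\<lambda>m. of_bool (bit s m)) [0..<l]) = list_encode (map of_bool \<sigma>) \<longleftrightarrow> \<sigma> = map (bit s) [0..<l]"
        for s l using inj_list_encode_map_of_bool[of "map (bit s) [0..<l]" \<sigma>] by (auto simp: comp_def)
      note enc = this
      have "(\<exists>w. Q (pfst w) (psnd w)) \<longleftrightarrow> (\<exists>n s. Q n s)" for Q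
        by (metis pfst_prod_encode psnd_prod_encode)
      from this[of "\<lambda>n s. k < n \<and> s < 2 ^ L n \<and> c n s \<and> \<sigma> = map (bit s) [0..<L n]"]
      show ?thesis unfolding p pfst_prod_encode psnd_prod_encode enc by blast
    qed
    have "V k = (\<Union>\<sigma>\<in>{\<sigma>. run no_oracle p (prod_encode (k, list_encode (map of_bool \<sigma>))) \<noteq> None}. cylinder \<sigma>)" for k
    proof -
      have "x \<in> V k \<longleftrightarrow> (\<exists>\<sigma>. (\<exists>n>k. \<exists>s<2 ^ L n. c n s \<and> \<sigma> = map (bit s) [0..<L n]) \<and> x \<in> cylinder \<sigma>)" for x
      proof -
        have "x \<in> V k \<longleftrightarrow> (\<exists>n>k. \<exists>s<2 ^ L n. c n s \<and> code (L n) x = s)"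
          unfolding V_def using code_less by blast
        also have "\<dots> \<longleftrightarrow> (\<exists>n>k. \<exists>s<2 ^ L n. c n s \<and> x \<in> cylinder (map (bit s) [0..<L n]))"
          unfolding mem_cylinder_map using code_eq_iff by metis
        finally show ?thesis by blast
      qed
      then show ?thesis unfolding dom by auto
    qed
    then show ?thesis unfolding effectively_open_seq_def by blast
  qed
  moreover have "computable_real_seq (\<lambda>k. measure cantor_measure (V k))"
  proof -
    \<comment> \<open>\<open>\<Lambda> j\<close> is at least every \<open>L n\<close> with
      \<open>n < j\<close>, so one prefix decides the truncated union.\<close>
    define \<Lambda> where "\<Lambda> n = (\<Sum>i<n. L i)" for n
    have L_le: "L n \<le> \<Lambda> j" if "n < j" for n j
      unfolding \<Lambda>_def using that by (intro member_le_sum) auto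
    define d where "d k j = real (\<Sum>s<2 ^ \<Lambda> j. of_bool (\<exists>n<j. k < n \<and> c n (take_bit (L n) s))) / 2 ^ \<Lambda> j" for k j
    have rec: "recursive_rat (\<lambda>A z. d (pfst z) (Suc (pfst z + psnd z)))"
      unfolding d_def \<Lambda>_def by (intro rec_intros)
    have d: "d k j = measure cantor_measure {x. \<exists>n<j. k < n \<and> c n (code (L n) x)}" for k j
    proof -
      have "{x. \<exists>n<j. k < n \<and> c n (code (L n) x)} = {x. \<exists>n<j. k < n \<and> c n (take_bit (L n) (code (\<Lambda> j) x))}"
        using take_bit_code[OF L_le] by auto
      then show ?thesis
        unfolding d_def using cantor.prob_code[of "\<lambda>s. \<exists>n<j. k < n \<and> c n (take_bit (L n) s)" "\<Lambda> j"]
        by (simp only:)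
    qed
    \<comment> \<open>The cut at \<open>Suc (k + j)\<close> keeps the indices up to
      \<open>k + j\<close>; what is lost lies in \<open>V (k + j)\<close>.\<close>
    have bound: "\<bar>d k (Suc (k + j)) - measure cantor_measure (V k)\<bar> \<le> 1 / 2 ^ j" for k j
    proof -
      let ?D = "{x. \<exists>n<Suc (k + j). k < n \<and> c n (code (L n) x)}"
      have D_sets: "?D \<in> sets cantor_measure"
      proof -
        have "?D = (\<Union>n\<in>{k<..<Suc (k + j)}. ?C n)" by auto
        then show ?thesis using cantor.sets_code by auto
      qed
      have "measure cantor_measure ?D \<le> measure cantor_measure (V k)"
        using V_sets by (intro cantor.finite_measure_mono) (auto simp: V_def)
      moreover have "measure cantor_measure (V k) \<le> measure cantor_measure (?D \<union> V (k + j))"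
      proof (intro cantor.finite_measure_mono subsetI)
        fix x assume "x \<in> V k"
        then obtain n where "k < n" "c n (code (L n) x)" by (auto simp: V_def)
        then show "x \<in> ?D \<union> V (k + j)" by (cases "n < Suc (k + j)") (auto simp: V_def not_less_eq)
      qed (use V_sets D_sets in auto)
      moreover have "\<dots> \<le> measure cantor_measure ?D + measure cantor_measure (V (k + j))"
        using V_sets D_sets by (intro measure_Un_le) auto
      moreover have "measure cantor_measure (V (k + j)) \<le> 1 / 2 ^ (k + j)" by (rule V_le)
      moreover have "(1::real) / 2 ^ (k + j) \<le> 1 / 2 ^ j"
        by (intro divide_left_mono power_increasing) auto
      ultimately show ?thesis unfolding d by linarith
    qed
    from recursive_rat_code[OF rec] obtain r where r: "recursive r"
      "\<And>A x. of_rat (nat_to_rat_surj (r A x)) = d (pfst x) (Suc (pfst x + psnd x))" by blast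
    then obtain p where p: "\<And>A x. run A p x = Some (r A x)" unfolding recursive_def by blast
    show ?thesis unfolding computable_real_seq_def computes_real_def
      by (intro exI[of _ p]) (simp add: p r(2) bound)
  qed
  moreover assume "\<not> (\<exists>k. \<forall>n>k. \<not> c n (code (L n) (join \<omega>)))"
  then have "join \<omega> \<in> (\<Inter>k. V k)" by (auto simp: V_def)
  ultimately show False using schnorr V_le unfolding schnorr_random_def by blast
qed

section \<open>Almost sure semidecidable events at Schnorr random points\<close>

lemma tendsto_prob_undecided:
  assumes "prob_space N" "\<And>t. {\<omega>\<in>space N. h t \<omega>} \<in> sets N" "AE \<omega> in N. \<exists>t. h t \<omega>"
    and "\<And>t t' \<omega>. h t \<omega> \<Longrightarrow> t \<le> t' \<Longrightarrow> h t' \<omega>"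
  shows "(\<lambda>t. measure N {\<omega>\<in>space N. \<not> h t \<omega>}) \<longlonglongrightarrow> 0"
proof -
  interpret prob_space N by fact
  have eq: "{\<omega>\<in>space N. \<not> h t \<omega>} = space N - {\<omega>\<in>space N. h t \<omega>}" for t by auto
  have s: "{\<omega>\<in>space N. \<not> h t \<omega>} \<in> sets N" for t unfolding eq using assms(2) by auto
  have "(\<lambda>t. measure N {\<omega>\<in>space N. \<not> h t \<omega>}) \<longlonglongrightarrow> measure N (\<Inter>t. {\<omega>\<in>space N. \<not> h t \<omega>})"
    using s assms(4) by (intro finite_Lim_measure_decseq) (auto simp: decseq_def)
  also have "measure N (\<Inter>t. {\<omega>\<in>space N. \<not> h t \<omega>}) = 0"
  proof -
    have "(\<Inter>t. {\<omega>\<in>space N. \<not> h t \<omega>}) \<in> null_sets N"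
      using assms(3) s by (subst AE_iff_null_sets) (auto)
    then show ?thesis by (simp add: measure_eq_0_null_sets)
  qed
  finally show ?thesis .
qed

text \<open>The probability of being undecided at stage \<open>t\<close> is a computable rational
  tending to \<open>0\<close>. Searching for stages where it is at most \<open>1 / 2 ^ n\<close>
  gives a sequence for the effective Borel-Cantelli lemma, so \<open>\<omega>\<close> is undecided
  at only finitely many of them.\<close>

lemma schnorr_decided:
  assumes schnorr: "schnorr_random \<omega>"
    and h: "decidable (\<lambda>A z. h (pfst z) (psnd z))"
    and ae: "AE \<xi> in seq_measure. \<exists>t. h t (code t (join \<xi>))"
    and mono: "\<And>t t' x. h t (code t x) \<Longrightarrow> t \<le> t' \<Longrightarrow> h t' (code t' x)"
  shows "\<exists>t. h t (code t (join \<omega>))"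
proof -
  note [rec_intros] = decidable_comp2[OF h]
  define q where "q t = real (\<Sum>s<2 ^ t. of_bool (\<not> h t s)) / 2 ^ t" for t
  have "q = (\<lambda>t. measure seq_measure {\<xi>\<in>space seq_measure. \<not> h t (code t (join \<xi>))})"
    unfolding q_def by (rule ext) (use seq.prob_code[of "\<lambda>s. \<not> h t s" t for t] in simp)
  moreover have "(\<lambda>t. measure seq_measure {\<xi>\<in>space seq_measure. \<not> h t (code t (join \<xi>))}) \<longlonglongrightarrow> 0"
    using ae mono by (intro tendsto_prob_undecided seq.prob_space_axioms) (auto simp: seq.sets_code)
  ultimately have lim: "q \<longlonglongrightarrow> 0" by (simp only:)
  have ex: "\<exists>t. q t \<le> 1 / 2 ^ n" for n :: nat
  proof -
    have "\<forall>\<^sub>F t in sequentially. q t < 1 / 2 ^ n" using lim by (rule order_tendstoD) simp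
    then show ?thesis by (auto simp: eventually_sequentially intro: less_imp_le)
  qed
  define T where "T n = (LEAST t. q t \<le> 1 / 2 ^ n)" for n :: nat
  have T: "q (T n) \<le> 1 / 2 ^ n" for n unfolding T_def using ex by (rule LeastI_ex)
  have "decidable (\<lambda>A z. q (psnd z) \<le> 1 / 2 ^ pfst z)" unfolding q_def by (intro rec_intros)
  then have recT: "recursive (\<lambda>A. T)" unfolding T_def using ex by (rule recursive_LEAST)
  note [rec_intros] = recursive_comp[OF recT]
  have "decidable (\<lambda>A z. \<not> h (T (pfst z)) (psnd z))" by (intro rec_intros)
  from schnorr_Borel_Cantelli[OF schnorr this recT] T[unfolded q_def]
  obtain k where "\<forall>n>k. \<not> \<not> h (T n) (code (T n) (join \<omega>))" by blast
  then show ?thesis by blast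
qed

text \<open>Membership in each \<open>U k\<close> is found by a decidable test on longer and longer
  prefixes. Success is almost sure, hence occurs at \<open>\<omega>\<close>.\<close>

lemma schnorr_mem_Pi02:
  assumes schnorr: "schnorr_random \<omega>" and "Pi02 D" "measure seq_measure D = 1"
  shows "\<omega> \<in> D"
proof -
  obtain U where "effectively_open_seq U" and D: "D = (\<Inter>k. join -` U k)"
    using assms(2) unfolding Pi02_def by blast
  then obtain p where U: "\<And>k. U k = (\<Union>\<sigma>\<in>{\<sigma>. run no_oracle p (prod_encode (k, list_encode (map of_bool \<sigma>))) \<noteq> None}. cylinder \<sigma>)"
    unfolding effectively_open_seq_def by blast
  \<comment> \<open>\<open>measure\<close> is \<open>0\<close> on sets that are not measurable, so
    measure one already gives measurability.\<close>
  have "D \<in> sets seq_measure" using assms(3) measure_notin_sets by fastforce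
  then have aeD: "AE \<xi> in seq_measure. \<xi> \<in> D" using assms(3) by (simp add: seq.AE_in_set_eq_1)
  have "join \<omega> \<in> U k" for k
  proof -
    \<comment> \<open>The constant \<open>1\<close> is \<open>no_oracle\<close> in the shifted
      coding.\<close>
    let ?S = "\<lambda>t l s. sim (\<lambda>_. 1) t p (prod_encode (k, list_encode (map (\<lambda>m. of_bool (bit s m)) [0..<l])))"
    \<comment> \<open>Strings of length at most \<open>t\<close> are tried, so the test reads only
      bits that \<open>code t\<close> contains.\<close>
    define h where "h t s = (\<exists>l<Suc t. 0 < ?S t l s)" for t s :: nat
    have 1: "decidable (\<lambda>A z. h (pfst z) (psnd z))"
      unfolding h_def by (intro rec_intros recursive_sim[where Q = "\<lambda>_ _ _. 1"])
    have enc: "map (\<lambda>m. of_bool (bit (code t x) m)) [0..<l] = (map of_bool (map x [0..<l]) :: nat list)"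
      if "l \<le> t" for t l x using that by simp
    have h: "h t (code t x) \<longleftrightarrow> (\<exists>l\<le>t. 0 < sim (\<lambda>_. 1) t p (prod_encode (k, list_encode (map of_bool (map x [0..<l])))))" for t x
      unfolding h_def less_Suc_eq_le by (intro ex_cong1 conj_cong refl) (simp only: enc)
    have sim: "run no_oracle p y \<noteq> None \<longleftrightarrow> (\<exists>t. 0 < sim (\<lambda>_. 1) t p y)" for y
    proof
      assume "run no_oracle p y \<noteq> None"
      then obtain v where "run no_oracle p y = Some v" by blast
      have "\<exists>t. sim (\<lambda>_. 1) t p y = Suc v"
        by (rule sim_complete[where Q = "\<lambda>_ _. 1" and A = no_oracle])
          (use \<open>run no_oracle p y = Some v\<close> in \<open>auto simp: no_oracle_def\<close>)
      then show "\<exists>t. 0 < sim (\<lambda>_. 1) t p y" by (metis zero_less_Suc)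
    next
      assume "\<exists>t. 0 < sim (\<lambda>_. 1) t p y"
      then obtain t v where "sim (\<lambda>_. 1) t p y = Suc v" by (auto simp: gr0_conv_Suc)
      from sim_sound[OF _ this] show "run no_oracle p y \<noteq> None"
        by (force simp: no_oracle_def)
    qed
    have sim_mono': "0 < sim (\<lambda>_. 1) t p y \<Longrightarrow> t \<le> t' \<Longrightarrow> 0 < sim (\<lambda>_. 1) t' p y" for t t' y
      using sim_mono[of "\<lambda>_. 1" "\<lambda>_. 1" t t' p y] by (auto simp: gr0_conv_Suc)
    have hU: "(\<exists>t. h t (code t x)) \<longleftrightarrow> x \<in> U k" for x
    proof
      assume "\<exists>t. h t (code t x)"
      then obtain l where "run no_oracle p (prod_encode (k, list_encode (map of_bool (map x [0..<l])))) \<noteq> None"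
        unfolding h sim by blast
      moreover have "x \<in> cylinder (map x [0..<l])" by (simp add: mem_cylinder_map)
      ultimately show "x \<in> U k" unfolding U by blast
    next
      assume "x \<in> U k"
      then obtain \<sigma> where \<sigma>: "run no_oracle p (prod_encode (k, list_encode (map of_bool \<sigma>))) \<noteq> None" "x \<in> cylinder \<sigma>"
        unfolding U by blast
      define l where "l = length \<sigma>"
      have "\<sigma> = map x [0..<l]" using \<sigma>(2) by (intro nth_equalityI) (auto simp: cylinder_def l_def)
      with \<sigma>(1) obtain t where t: "0 < sim (\<lambda>_. 1) t p (prod_encode (k, list_encode (map of_bool (map x [0..<l]))))"
        unfolding sim by blast
      have "h (max t l) (code (max t l) x)"
        unfolding h using sim_mono'[OF t, of "max t l"] by (intro exI[of _ l]) simp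
      then show "\<exists>t. h t (code t x)" by blast
    qed
    have "AE \<xi> in seq_measure. \<exists>t. h t (code t (join \<xi>))"
      using aeD unfolding hU by eventually_elim (auto simp: D)
    moreover have "h t (code t x) \<Longrightarrow> t \<le> t' \<Longrightarrow> h t' (code t' x)" for t t' x
      unfolding h using sim_mono' order.trans by blast
    ultimately have "\<exists>t. h t (code t (join \<omega>))" by (rule schnorr_decided[OF schnorr 1])
    then show ?thesis unfolding hU .
  qed
  then show ?thesis by (auto simp: D)
qed

subsection \<open>Conditional expectations\<close>

interpretation seq2: pair_sigma_finite seq_measure seq_measure ..

lemma measurable_comb_seq_seq [measurable (raw)]:
  "f \<in> N \<rightarrow>\<^sub>M seq_measure \<Longrightarrow> g \<in> N \<rightarrow>\<^sub>M seq_measure \<Longrightarrow> (\<lambda>x. comb_seq i (f x) (g x)) \<in> N \<rightarrow>\<^sub>M seq_measure"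
  unfolding seq_measure_def by measurable

lemma distr_comb_seq:
  "distr (seq_measure \<Otimes>\<^sub>M seq_measure) seq_measure (\<lambda>(\<omega>, \<xi>). comb_seq i \<omega> \<xi>) = seq_measure"
  unfolding seq_measure_def by (rule cseq.PiM_comb_seq)

lemma integrable_comb_seq:
  fixes g :: "_ \<Rightarrow> real"
  assumes "integrable seq_measure g"
  shows "integrable (seq_measure \<Otimes>\<^sub>M seq_measure) (\<lambda>(\<omega>, \<xi>). g (comb_seq i \<omega> \<xi>))"
proof -
  have "integrable (distr (seq_measure \<Otimes>\<^sub>M seq_measure) seq_measure (\<lambda>(\<omega>, \<xi>). comb_seq i \<omega> \<xi>)) g"
    unfolding distr_comb_seq by fact
  then show ?thesis
    by (subst (asm) integrable_distr_eq) (use assms in \<open>auto simp: split_beta'\<close>)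
qed

text \<open>Splicing \<open>\<omega>\<close> with an independent \<open>\<xi>\<close> at coordinate
  \<open>i\<close> preserves the measure, so all three claims are Fubini's theorem for the composed
  function.\<close>

lemma
  fixes g :: "_ \<Rightarrow> real"
  assumes "integrable seq_measure g"
  shows integrable_cond_exp: "integrable seq_measure (cond_exp i g)"
    and integral_cond_exp: "(\<integral>\<omega>. cond_exp i g \<omega> \<partial>seq_measure) = (\<integral>\<omega>. g \<omega> \<partial>seq_measure)"
    and AE_integrable_section: "AE \<omega> in seq_measure. integrable seq_measure (\<lambda>\<xi>. g (comb_seq i \<omega> \<xi>))"
proof -
  note int = integrable_comb_seq[OF assms, of i]
  show "integrable seq_measure (cond_exp i g)"
    using seq2.integrable_fst'[OF int] by (simp add: cond_exp_def[abs_def])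
  show "AE \<omega> in seq_measure. integrable seq_measure (\<lambda>\<xi>. g (comb_seq i \<omega> \<xi>))"
    using seq2.AE_integrable_fst'[OF int] by simp
  have "(\<integral>\<omega>. g \<omega> \<partial>seq_measure) = (\<integral>\<omega>. g \<omega> \<partial>distr (seq_measure \<Otimes>\<^sub>M seq_measure) seq_measure (\<lambda>(\<omega>, \<xi>). comb_seq i \<omega> \<xi>))"
    unfolding distr_comb_seq ..
  also have "\<dots> = (\<integral>z. (\<lambda>(\<omega>, \<xi>). g (comb_seq i \<omega> \<xi>)) z \<partial>(seq_measure \<Otimes>\<^sub>M seq_measure))"
    by (subst integral_distr) (use assms in \<open>auto simp: split_beta'\<close>)
  also have "\<dots> = (\<integral>\<omega>. cond_exp i g \<omega> \<partial>seq_measure)"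
    using seq2.integral_fst'[OF int] by (simp add: cond_exp_def)
  finally show "(\<integral>\<omega>. cond_exp i g \<omega> \<partial>seq_measure) = (\<integral>\<omega>. g \<omega> \<partial>seq_measure)" ..
qed

text \<open>Sections are integrable only almost everywhere, so the triangle inequality for the inner
  integral is an almost sure statement; integrating it removes the conditional expectation.\<close>

lemma cond_exp_L1_contraction:
  fixes g h :: "_ \<Rightarrow> real"
  assumes g: "integrable seq_measure g" and h: "integrable seq_measure h"
  shows "(\<integral>\<omega>. \<bar>cond_exp i g \<omega> - cond_exp i h \<omega>\<bar> \<partial>seq_measure) \<le> (\<integral>\<omega>. \<bar>g \<omega> - h \<omega>\<bar> \<partial>seq_measure)"
proof -
  have gh: "integrable seq_measure (\<lambda>\<omega>. \<bar>g \<omega> - h \<omega>\<bar>)" using g h by auto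
  have "(\<integral>\<omega>. \<bar>cond_exp i g \<omega> - cond_exp i h \<omega>\<bar> \<partial>seq_measure) \<le> (\<integral>\<omega>. cond_exp i (\<lambda>\<omega>. \<bar>g \<omega> - h \<omega>\<bar>) \<omega> \<partial>seq_measure)"
  proof (rule integral_mono_AE)
    show "integrable seq_measure (\<lambda>\<omega>. \<bar>cond_exp i g \<omega> - cond_exp i h \<omega>\<bar>)"
      using integrable_cond_exp[OF g] integrable_cond_exp[OF h] by auto
    show "integrable seq_measure (cond_exp i (\<lambda>\<omega>. \<bar>g \<omega> - h \<omega>\<bar>))"
      by (rule integrable_cond_exp[OF gh])
    show "AE \<omega> in seq_measure. \<bar>cond_exp i g \<omega> - cond_exp i h \<omega>\<bar> \<le> cond_exp i (\<lambda>\<omega>. \<bar>g \<omega> - h \<omega>\<bar>) \<omega>"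
      using AE_integrable_section[OF g, of i] AE_integrable_section[OF h, of i]
    proof eventually_elim
      case (elim \<omega>)
      then have "cond_exp i g \<omega> - cond_exp i h \<omega> = (\<integral>\<xi>. g (comb_seq i \<omega> \<xi>) - h (comb_seq i \<omega> \<xi>) \<partial>seq_measure)"
        by (simp add: cond_exp_def)
      also have "\<bar>\<dots>\<bar> \<le> (\<integral>\<xi>. \<bar>g (comb_seq i \<omega> \<xi>) - h (comb_seq i \<omega> \<xi>)\<bar> \<partial>seq_measure)"
        by (rule integral_abs_bound)
      finally show ?case by (simp add: cond_exp_def)
    qed
  qed
  also have "\<dots> = (\<integral>\<omega>. \<bar>g \<omega> - h \<omega>\<bar> \<partial>seq_measure)" by (rule integral_cond_exp[OF gh])
  finally show ?thesis .
qed

lemma comb_seq_comb_seq: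
  "m \<le> n \<Longrightarrow> comb_seq n (comb_seq m \<omega> \<xi>) \<eta> = comb_seq m \<omega> (comb_seq (n - m) \<xi> \<eta>)"
  by (auto simp: comb_seq_def fun_eq_iff)

lemma integrable_section:
  fixes g :: "_ \<Rightarrow> real"
  assumes [measurable]: "g \<in> borel_measurable seq_measure" and "\<And>\<omega>. \<bar>g \<omega>\<bar> \<le> b"
  shows "integrable seq_measure (\<lambda>\<xi>. g (comb_seq i \<omega> \<xi>))"
  by (rule seq.integrable_const_bound[where B = b]) (use assms(2) in auto)

text \<open>Splicing at \<open>m\<close> and then at \<open>n\<close> is one splicing at
  \<open>m\<close> with a tail spliced at \<open>n - m\<close>, and such a tail has the law of a
  fresh one. Boundedness makes every section integrable, so the identity holds at every
  point.\<close>

lemma cond_exp_tower: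
  fixes g :: "_ \<Rightarrow> real"
  assumes "g \<in> borel_measurable seq_measure" "\<And>\<omega>. \<bar>g \<omega>\<bar> \<le> b" "m \<le> n"
  shows "cond_exp m (cond_exp n g) \<omega> = cond_exp m g \<omega>"
proof -
  let ?G = "\<lambda>\<xi>. g (comb_seq m \<omega> \<xi>)"
  have "cond_exp m (cond_exp n g) \<omega> = (\<integral>\<xi>. cond_exp (n - m) ?G \<xi> \<partial>seq_measure)"
    using assms(3) by (simp add: cond_exp_def comb_seq_comb_seq)
  also have "\<dots> = (\<integral>\<xi>. ?G \<xi> \<partial>seq_measure)"
    by (rule integral_cond_exp[OF integrable_section[OF assms(1,2)]])
  finally show ?thesis by (simp add: cond_exp_def)
qed

lemma borel_measurable_cond_exp [measurable]:
  fixes g :: "_ \<Rightarrow> real"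
  assumes [measurable]: "g \<in> borel_measurable seq_measure"
  shows "cond_exp i g \<in> borel_measurable seq_measure"
  unfolding cond_exp_def[abs_def] by measurable

lemma cond_exp_cong_prefix:
  assumes "\<And>j. j < i \<Longrightarrow> \<omega> j = \<omega>' j"
  shows "cond_exp i g \<omega> = cond_exp i g \<omega>'"
proof -
  have "comb_seq i \<omega> \<xi> = comb_seq i \<omega>' \<xi>" for \<xi> using assms by (auto simp: comb_seq_def)
  then show ?thesis by (simp add: cond_exp_def)
qed

lemma cond_exp_adapted:
  assumes "\<And>\<omega> \<omega>'. (\<And>j. j < i \<Longrightarrow> \<omega> j = \<omega>' j) \<Longrightarrow> g \<omega> = g \<omega>'"
  shows "cond_exp i g \<omega> = g \<omega>"
proof -
  have "g (comb_seq i \<omega> \<xi>) = g \<omega>" for \<xi> by (rule assms) (simp add: comb_seq_def)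
  then show ?thesis by (simp add: cond_exp_def seq.prob_space[simplified])
qed

subsection \<open>Stopped martingale of a sequence of approximants\<close>

locale approximants =
  fixes f :: "nat \<Rightarrow> (nat \<Rightarrow> cantor) \<Rightarrow> real" and B :: "nat \<Rightarrow> real" and C :: real
  assumes f_nonneg: "\<And>n \<omega>. 0 \<le> f n \<omega>"
    and f_le: "\<And>n \<omega>. f n \<omega> \<le> B n"
    and f_measurable [measurable]: "\<And>n. f n \<in> borel_measurable seq_measure"
    and f_adapted: "\<And>n \<omega> \<omega>'. (\<And>j. j < n \<Longrightarrow> \<omega> j = \<omega>' j) \<Longrightarrow> f n \<omega> = f n \<omega>'"
    and C_nonneg: "0 \<le> C"
begin

definition predicted :: "nat \<Rightarrow> (nat \<Rightarrow> cantor) \<Rightarrow> real" where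
  "predicted i = cond_exp i (f (Suc i))"

definition defect :: "nat \<Rightarrow> (nat \<Rightarrow> cantor) \<Rightarrow> real" where
  "defect i \<omega> = \<bar>predicted i \<omega> - f i \<omega>\<bar>"

text \<open>The test includes \<open>defect i\<close>, which like \<open>predicted i\<close> is
  determined by the first \<open>i\<close> coordinates, so it is settled before
  \<open>f (Suc i)\<close> is seen. Defects are nonnegative, so a failed test keeps failing.
  \<open>C\<close> is both the extra capital and the cap on the total defect.\<close>

definition stopped :: "nat \<Rightarrow> (nat \<Rightarrow> cantor) \<Rightarrow> real" where
  "stopped n \<omega> = C + f 0 \<omega> +
     (\<Sum>i<n. if (\<Sum>j<Suc i. defect j \<omega>) \<le> C then f (Suc i) \<omega> - predicted i \<omega> else 0)"

lemma defect_nonneg: "0 \<le> defect i \<omega>"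
  by (simp add: defect_def)

lemma f_abs_le: "\<bar>f n \<omega>\<bar> \<le> B n"
  using f_nonneg f_le by simp

lemma predicted_measurable [measurable]: "predicted i \<in> borel_measurable seq_measure"
  unfolding predicted_def by measurable

lemma defect_measurable [measurable]: "defect i \<in> borel_measurable seq_measure"
  unfolding defect_def[abs_def] by measurable

lemma stopped_measurable [measurable]: "stopped n \<in> borel_measurable seq_measure"
  unfolding stopped_def[abs_def] by measurable

lemma predicted_nonneg: "0 \<le> predicted i \<omega>"
  unfolding predicted_def cond_exp_def by (intro integral_nonneg_AE) (simp add: f_nonneg)

lemma predicted_adapted: "(\<And>j. j < i \<Longrightarrow> \<omega> j = \<omega>' j) \<Longrightarrow> predicted i \<omega> = predicted i \<omega>'"
  unfolding predicted_def by (rule cond_exp_cong_prefix)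

lemma defect_adapted: "(\<And>j. j < i \<Longrightarrow> \<omega> j = \<omega>' j) \<Longrightarrow> defect i \<omega> = defect i \<omega>'"
  unfolding defect_def using predicted_adapted[of i \<omega> \<omega>'] f_adapted[of i \<omega> \<omega>'] by simp

lemma stopped_adapted:
  assumes "\<And>j. j < n \<Longrightarrow> \<omega> j = \<omega>' j"
  shows "stopped n \<omega> = stopped n \<omega>'"
proof -
  have "f i \<omega> = f i \<omega>'" if "i \<le> n" for i using that assms by (intro f_adapted) auto
  moreover have "predicted i \<omega> = predicted i \<omega>'" if "i \<le> n" for i using that assms by (intro predicted_adapted) auto
  moreover have "defect i \<omega> = defect i \<omega>'" if "i \<le> n" for i using that assms by (intro defect_adapted) auto
  ultimately show ?thesis unfolding stopped_def
    by (intro arg_cong2[where f = plus] sum.cong if_cong arg_cong2[where f = "(\<le>)"]) auto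
qed

text \<open>The increment \<open>f (Suc i) - predicted i\<close> is \<open>f (Suc i) - f i\<close>,
  which telescopes, plus \<open>f i - predicted i\<close>.\<close>

lemma stopped_unstopped:
  assumes "(\<Sum>j<n. defect j \<omega>) \<le> C"
  shows "stopped n \<omega> = C + f n \<omega> + (\<Sum>i<n. f i \<omega> - predicted i \<omega>)"
  using assms
proof (induction n)
  case (Suc n)
  have "(\<Sum>j<n. defect j \<omega>) \<le> (\<Sum>j<Suc n. defect j \<omega>)" by (simp add: defect_def)
  with Suc have "stopped n \<omega> = C + f n \<omega> + (\<Sum>i<n. f i \<omega> - predicted i \<omega>)" by linarith
  with Suc.prems show ?case by (simp add: stopped_def)
qed (simp add: stopped_def)

text \<open>While running, the process is at least \<open>C\<close> minus the defects spent, which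
  the test keeps nonnegative; afterwards it keeps its last value.\<close>

lemma stopped_nonneg: "0 \<le> stopped n \<omega>"
proof (induction n)
  case 0
  show ?case using C_nonneg f_nonneg by (simp add: stopped_def)
next
  case (Suc n)
  show ?case
  proof (cases "(\<Sum>j<Suc n. defect j \<omega>) \<le> C")
    case True
    have "(\<Sum>i<Suc n. f i \<omega> - predicted i \<omega>) \<ge> (\<Sum>i<Suc n. - defect i \<omega>)"
      by (rule sum_mono) (simp add: defect_def)
    with True f_nonneg[of "Suc n" \<omega>] show ?thesis
      unfolding stopped_unstopped[OF True] sum_negf by linarith
  next
    case False
    then have "stopped (Suc n) \<omega> = stopped n \<omega>" by (simp add: stopped_def)
    with Suc show ?thesis by simp
  qed
qed

lemma stopped_le: "stopped n \<omega> \<le> C + B 0 + (\<Sum>i<n. B (Suc i))"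
proof -
  have "(if (\<Sum>j<Suc i. defect j \<omega>) \<le> C then f (Suc i) \<omega> - predicted i \<omega> else 0) \<le> B (Suc i)" for i
    using f_le[of "Suc i" \<omega>] predicted_nonneg[of i \<omega>] f_nonneg[of "Suc i" \<omega>] by auto
  then show ?thesis unfolding stopped_def using f_le[of 0 \<omega>] by (intro add_mono sum_mono) auto
qed

lemma stopped_abs_le: "\<bar>stopped n \<omega>\<bar> \<le> C + B 0 + (\<Sum>i<n. B (Suc i))"
  using stopped_nonneg stopped_le by simp

lemma integrable_stopped: "integrable seq_measure (stopped n)"
  by (rule seq.integrable_const_bound[where B = "C + B 0 + (\<Sum>i<n. B (Suc i))"])
    (use stopped_abs_le in auto)

text \<open>Given the first \<open>n\<close> coordinates the test is constant and
  \<open>predicted n\<close> is the mean of \<open>f (Suc n)\<close>, so the increment has mean zero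
  in either case.\<close>

lemma cond_exp_stopped_Suc: "cond_exp n (stopped (Suc n)) \<omega> = stopped n \<omega>"
proof -
  let ?c = "\<lambda>\<omega>. (\<Sum>j<Suc n. defect j \<omega>) \<le> C"
  have adapt: "stopped n (comb_seq n \<omega> \<xi>) = stopped n \<omega>" "predicted n (comb_seq n \<omega> \<xi>) = predicted n \<omega>"
     "defect j (comb_seq n \<omega> \<xi>) = defect j \<omega>" if "j < Suc n" for \<xi> j
    using that by (auto intro!: stopped_adapted predicted_adapted defect_adapted simp: comb_seq_def)
  have eq: "stopped (Suc n) \<xi> = stopped n \<xi> + (if ?c \<xi> then f (Suc n) \<xi> - predicted n \<xi> else 0)" for \<xi>
    by (simp add: stopped_def)
  have c: "?c (comb_seq n \<omega> \<xi>) \<longleftrightarrow> ?c \<omega>" for \<xi>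
    using adapt(3) by (intro arg_cong2[where f = "(\<le>)"] sum.cong) auto
  have int: "integrable seq_measure (\<lambda>\<xi>. f (Suc n) (comb_seq n \<omega> \<xi>))"
    by (rule integrable_section[OF f_measurable f_abs_le])
  have "cond_exp n (stopped (Suc n)) \<omega> =
      (\<integral>\<xi>. stopped n \<omega> + (if ?c \<omega> then f (Suc n) (comb_seq n \<omega> \<xi>) - predicted n \<omega> else 0) \<partial>seq_measure)"
    unfolding cond_exp_def eq c adapt(1)[OF lessI] adapt(2)[OF lessI] ..
  also have "\<dots> = stopped n \<omega>"
  proof (cases "?c \<omega>")
    case True
    then show ?thesis using int
      by (simp add: predicted_def cond_exp_def[of n "f (Suc n)"] seq.prob_space[simplified])
  next
    case False
    then show ?thesis by (simp add: seq.prob_space[simplified])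
  qed
  finally show ?thesis .
qed

lemma cond_exp_stopped:
  assumes "m \<le> n" shows "cond_exp m (stopped n) \<omega> = stopped m \<omega>"
  using assms
proof (induction n rule: dec_induct)
  case base
  show ?case by (rule cond_exp_adapted[OF stopped_adapted])
next
  case (step n)
  have "cond_exp m (stopped (Suc n)) \<omega> = cond_exp m (cond_exp n (stopped (Suc n))) \<omega>"
    by (rule cond_exp_tower[symmetric, OF stopped_measurable stopped_abs_le]) (use step in simp)
  also have "cond_exp n (stopped (Suc n)) = stopped n" using cond_exp_stopped_Suc by blast
  finally show ?case using step by simp
qed

lemma stopped_martingale:
  assumes "\<And>n. \<exists>g. \<forall>\<omega>. stopped n \<omega> = g (initial n \<omega>)"
  shows "nonneg_martingale stopped"
proof -
  have "\<exists>g. AE \<omega> in seq_measure. stopped n \<omega> = g (initial n \<omega>)" for n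
  proof -
    from assms[of n] obtain g where "\<And>\<omega>. stopped n \<omega> = g (initial n \<omega>)" by blast
    then have "AE \<omega> in seq_measure. stopped n \<omega> = g (initial n \<omega>)" by simp
    then show ?thesis by blast
  qed
  then show ?thesis
    unfolding nonneg_martingale_def martingale_def
    by (simp add: integrable_stopped cond_exp_stopped stopped_nonneg)
qed

lemma convergent_stopped_iff:
  assumes "\<And>n. (\<Sum>j<n. defect j \<omega>) \<le> C"
  shows "convergent (\<lambda>n. stopped n \<omega>) \<longleftrightarrow> convergent (\<lambda>n. f n \<omega>)"
proof -
  have "(\<Sum>j\<le>n. defect j \<omega>) \<le> C" for n using assms[of "Suc n"] by (simp only: lessThan_Suc_atMost)
  then have "summable (\<lambda>i. defect i \<omega>)"
    by (intro bounded_imp_summable[where B = C]) (auto simp: defect_def)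
  then have "summable (\<lambda>i. norm (f i \<omega> - predicted i \<omega>))"
    by (simp add: defect_def abs_minus_commute)
  then have *: "convergent (\<lambda>n. C + (\<Sum>i<n. f i \<omega> - predicted i \<omega>))"
    by (intro convergent_add convergent_const) (simp add: summable_norm_cancel summable_iff_convergent[symmetric])
  have eq: "stopped n \<omega> = f n \<omega> + (C + (\<Sum>i<n. f i \<omega> - predicted i \<omega>))" for n
    using stopped_unstopped[OF assms] by simp
  show ?thesis
  proof
    assume "convergent (\<lambda>n. stopped n \<omega>)"
    from convergent_diff[OF this *] show "convergent (\<lambda>n. f n \<omega>)" by (simp add: eq)
  next
    assume "convergent (\<lambda>n. f n \<omega>)"
    from convergent_add[OF this *] show "convergent (\<lambda>n. stopped n \<omega>)" by (simp only: eq)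
  qed
qed

end

subsection \<open>Dyadic approximations of coded rationals\<close>

text \<open>The absolute value of \<open>int_decode n\<close>, which is negative exactly for odd
  \<open>n\<close>.\<close>

definition int_code_abs :: "nat \<Rightarrow> nat" where
  "int_code_abs n = (if odd n then Suc (n div 2) else n div 2)"

text \<open>The numerator over \<open>2 ^ k\<close> of the coded rational, cut off at
  \<open>0\<close> and rounded down; equal parities mean equal signs. A zero denominator gives
  \<open>0\<close>, in agreement with \<open>Fract\<close>.\<close>

definition dyadic :: "nat \<Rightarrow> nat \<Rightarrow> nat" where
  "dyadic k c = (if pfst c mod 2 = psnd c mod 2
     then 2 ^ k * int_code_abs (pfst c) div int_code_abs (psnd c) else 0)"

lemma recursive_int_code_abs [rec_intros]:
  assumes "recursive c" shows "recursive (\<lambda>A x. int_code_abs (c A x))"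
  unfolding int_code_abs_def by (intro rec_intros assms)

lemma recursive_dyadic [rec_intros]:
  assumes "recursive k" "recursive c"
  shows "recursive (\<lambda>A x. dyadic (k A x) (c A x))"
  unfolding dyadic_def by (intro rec_intros assms)

lemma int_decode_eq: "int_decode n = (if odd n then - int (int_code_abs n) else int (int_code_abs n))"
  by (auto simp: int_decode_def sum_decode_def int_code_abs_def)

lemma dyadic_approx:
  "\<bar>real (dyadic k c) / 2 ^ k - max 0 (of_rat (nat_to_rat_surj c))\<bar> \<le> 1 / 2 ^ k"
proof -
  let ?a = "int_code_abs (pfst c)" and ?b = "int_code_abs (psnd c)"
  have "nat_to_rat_surj c = Fract (int_decode (pfst c)) (int_decode (psnd c))"
    using nat_to_rat_surj_prod_encode[of "pfst c" "psnd c"] by simp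
  then have rat: "of_rat (nat_to_rat_surj c) = real_of_int (int_decode (pfst c)) / real_of_int (int_decode (psnd c))"
    by (cases "int_decode (psnd c) = 0") (simp_all add: of_rat_rat eq_rat Zero_rat_def)
  show ?thesis
  proof (cases "pfst c mod 2 = psnd c mod 2")
    case True
    then have "odd (pfst c) = odd (psnd c)" by (simp add: odd_iff_mod_2_eq_one)
    then have r: "of_rat (nat_to_rat_surj c) = real ?a / real ?b"
      unfolding rat int_decode_eq by auto
    have eq: "real (2 ^ k * ?a div ?b) / 2 ^ k - max 0 (real ?a / real ?b) =
        (real (2 ^ k * ?a div ?b) - real (2 ^ k * ?a) / real ?b) / 2 ^ k"
      by (simp add: diff_divide_distrib)
    have "\<bar>real (2 ^ k * ?a div ?b) - real (2 ^ k * ?a) / real ?b\<bar> \<le> 1"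
      using floor_divide_of_nat_eq[of "2 ^ k * ?a" ?b, where 'a = real, symmetric] floor_correct[of "real (2 ^ k * ?a) / real ?b"]
      by linarith
    then have "\<bar>(real (2 ^ k * ?a div ?b) - real (2 ^ k * ?a) / real ?b) / 2 ^ k\<bar> \<le> 1 / 2 ^ k"
      by (simp add: abs_divide divide_right_mono)
    then show ?thesis unfolding dyadic_def r if_P[OF True] eq by simp
  next
    case False
    then have "odd (pfst c) \<noteq> odd (psnd c)" by presburger
    then have "of_rat (nat_to_rat_surj c) = - (real ?a / real ?b)"
      unfolding rat int_decode_eq by auto
    then have "of_rat (nat_to_rat_surj c) \<le> (0::real)" by simp
    with False show ?thesis by (simp add: dyadic_def)
  qed
qed

text \<open>Cutting off at \<open>0\<close> moves no number away from the nonnegative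
  \<open>y\<close>; the Cauchy name and the rounding cost \<open>1 / 2 ^ k\<close> each.\<close>

lemma dyadic_approx_nonneg:
  assumes "\<bar>of_rat (nat_to_rat_surj c) - y\<bar> \<le> 1 / 2 ^ k" "0 \<le> y"
  shows "\<bar>real (dyadic k c) / 2 ^ k - y\<bar> \<le> 2 / 2 ^ k"
proof -
  have "\<bar>max 0 r - y\<bar> \<le> \<bar>r - y\<bar>" for r
    using assms(2) by (auto simp: max_def abs_if)
  note this[of "of_rat (nat_to_rat_surj c)"]
  moreover have "2 / 2 ^ k = 2 * (1 / 2 ^ k :: real)" by simp
  ultimately show ?thesis using dyadic_approx[of k c] assms(1) by linarith
qed

lemma computes_real_unique:
  assumes "computes_real p A n x" "computes_real p A n y"
  shows "x = y"
proof -
  have "\<bar>x - y\<bar> \<le> 2 / 2 ^ k" for k :: nat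
  proof -
    from assms obtain c where "\<bar>of_rat (nat_to_rat_surj c) - x\<bar> \<le> 1 / 2 ^ k" "\<bar>of_rat (nat_to_rat_surj c) - y\<bar> \<le> 1 / 2 ^ k"
      unfolding computes_real_def by (metis option.inject)
    then show ?thesis by linarith
  qed
  moreover have "(\<lambda>k. 2 / 2 ^ k :: real) \<longlonglongrightarrow> 0"
    using tendsto_mult_right[OF LIMSEQ_inverse_realpow_zero[of 2], of 2] by (simp add: divide_inverse power_inverse)
  ultimately have "\<bar>x - y\<bar> \<le> 0" by (intro LIMSEQ_le_const) auto
  then show ?thesis by simp
qed

lemma initial_oracle_initial:
  "initial_oracle (initial n \<omega>) m = (if pfst m < n then of_bool (join \<omega> m) else 0)"
  by (simp add: initial_oracle_def initial_def join_def pfst_def split: prod.split)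

lemma initial_oracle_cong:
  assumes "\<And>j. j < n \<Longrightarrow> \<omega> j = \<omega>' j"
  shows "initial_oracle (initial n \<omega>) = initial_oracle (initial n \<omega>')"
proof -
  have "map \<omega> [0..<n] = map \<omega>' [0..<n]" using assms by simp
  then show ?thesis by (simp only: initial_def)
qed

subsection \<open>Step function approximants of an almost everywhere computable martingale\<close>

locale ae_martingale =
  fixes M :: "nat \<Rightarrow> (nat \<Rightarrow> cantor) \<Rightarrow> real" and p :: prog
  assumes M: "nonneg_martingale M"
    and AE_computes: "\<And>n. AE \<omega> in seq_measure. computes_real p (initial_oracle (initial n \<omega>)) n (M n \<omega>)"
begin

lemma M_nonneg: "0 \<le> M n \<omega>"
  and M_integrable: "integrable seq_measure (M n)"
  and M_cond_exp: "m \<le> n \<Longrightarrow> AE \<omega> in seq_measure. cond_exp m (M n) \<omega> = M m \<omega>"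
  using M unfolding nonneg_martingale_def martingale_def by auto

text \<open>The \<open>2 * n\<close> leaves room for Markov's inequality at level
  \<open>1 / 2 ^ n\<close>. The \<open>5\<close> absorbs the factor 16 of the L1 bounds: those at
  \<open>n\<close> and \<open>Suc n\<close> add up to (5/8) / 4^n.\<close>

definition prec :: "nat \<Rightarrow> nat" where "prec n = 2 * n + 5"

text \<open>In the shifted coding, positions from \<open>t\<close> on are unknown, and known
  positions in rows from \<open>n\<close> on have the value \<open>0\<close>, as in
  \<open>initial_oracle\<close>.\<close>

definition finite_oracle :: "nat \<Rightarrow> nat \<Rightarrow> nat \<Rightarrow> nat \<Rightarrow> nat" where
  "finite_oracle n t s m = (if m < t then if pfst m < n then Suc (of_bool (bit s m)) else 1 else 0)"

definition out :: "nat \<Rightarrow> nat \<Rightarrow> nat \<Rightarrow> nat" where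
  "out n t s = sim (finite_oracle n t s) t p (prod_encode (n, prec n))"

text \<open>The default \<open>0\<close> on undecided strings never exceeds the nonnegative
  \<open>M n\<close>, which keeps the L1 error one-sided up to rounding.\<close>

definition approx :: "nat \<Rightarrow> nat \<Rightarrow> nat \<Rightarrow> nat" where
  "approx n t s = (if out n t s = 0 then 0 else dyadic (prec n) (out n t s - 1))"

lemma recursive_prec [rec_intros]: "recursive n \<Longrightarrow> recursive (\<lambda>A x. prec (n A x))"
  unfolding prec_def by (intro rec_intros)

lemma recursive_out [rec_intros]:
  assumes "recursive n" "recursive t" "recursive s"
  shows "recursive (\<lambda>A x. out (n A x) (t A x) (s A x))"
  unfolding out_def finite_oracle_def
  by (intro recursive_sim rec_intros assms recursive_comp[OF assms(1)] recursive_comp[OF assms(2)]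
      recursive_comp[OF assms(3)])

lemma recursive_approx [rec_intros]:
  assumes "recursive n" "recursive t" "recursive s"
  shows "recursive (\<lambda>A x. approx (n A x) (t A x) (s A x))"
  unfolding approx_def by (intro rec_intros assms)

lemma finite_oracle_code:
  "finite_oracle n t (code t (join \<omega>)) m = (if m < t then Suc (initial_oracle (initial n \<omega>) m) else 0)"
  by (simp add: finite_oracle_def initial_oracle_initial)

lemma finite_oracle_code':
  "finite_oracle n t (code t (join \<omega>)) = (\<lambda>m. if m < t then Suc (initial_oracle (initial n \<omega>) m) else 0)"
  by (rule ext) (rule finite_oracle_code)

lemma out_sound:
  "out n t (code t (join \<omega>)) = Suc c \<Longrightarrow>
    run (initial_oracle (initial n \<omega>)) p (prod_encode (n, prec n)) = Some c"
  unfolding out_def by (rule sim_sound) (auto simp: finite_oracle_code split: if_splits)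

lemma out_complete:
  "run (initial_oracle (initial n \<omega>)) p (prod_encode (n, prec n)) = Some c \<Longrightarrow>
    \<exists>t. out n t (code t (join \<omega>)) = Suc c"
  unfolding out_def finite_oracle_code' by (rule sim_complete) (auto split: if_splits)

lemma out_mono:
  assumes "0 < out n t (code t (join \<omega>))" "t \<le> t'"
  shows "0 < out n t' (code t' (join \<omega>))"
proof -
  from assms(1) obtain c where "out n t (code t (join \<omega>)) = Suc c" by (auto simp: gr0_conv_Suc)
  from sim_mono[OF _ assms(2) this[unfolded out_def], of "finite_oracle n t' (code t' (join \<omega>))"]
  have "out n t' (code t' (join \<omega>)) = Suc c"
    unfolding out_def finite_oracle_code using assms(2) by (auto split: if_splits)
  then show ?thesis by simp
qed

lemma out_adapted:
  assumes "\<And>j. j < n \<Longrightarrow> \<omega> j = \<omega>' j"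
  shows "out n t (code t (join \<omega>)) = out n t (code t (join \<omega>'))"
proof -
  have eq: "initial_oracle (initial n \<omega>) = initial_oracle (initial n \<omega>')"
    using assms by (rule initial_oracle_cong)
  show ?thesis unfolding out_def finite_oracle_code' eq ..
qed

lemma approx_error:
  assumes "computes_real p (initial_oracle (initial n \<omega>)) n (M n \<omega>)" "0 < out n t (code t (join \<omega>))"
  shows "\<bar>real (approx n t (code t (join \<omega>))) / 2 ^ prec n - M n \<omega>\<bar> \<le> 2 / 2 ^ prec n"
proof -
  from assms(2) obtain c where c: "out n t (code t (join \<omega>)) = Suc c" by (auto simp: gr0_conv_Suc)
  from assms(1) out_sound[OF c] have "\<bar>of_rat (nat_to_rat_surj c) - M n \<omega>\<bar> \<le> 1 / 2 ^ prec n"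
    unfolding computes_real_def by (metis option.inject)
  from dyadic_approx_nonneg[OF this M_nonneg] show ?thesis by (simp add: approx_def c)
qed

lemma AE_out: "AE \<omega> in seq_measure. \<exists>t. 0 < out n t (code t (join \<omega>))"
  using AE_computes[of n]
proof eventually_elim
  case (elim \<omega>)
  then obtain c where "run (initial_oracle (initial n \<omega>)) p (prod_encode (n, prec n)) = Some c"
    unfolding computes_real_def by blast
  from out_complete[OF this] show ?case by (metis zero_less_Suc)
qed

text \<open>\<open>initial 0 \<omega>\<close> is empty, so \<open>p\<close> produces the same name
  of \<open>M 0 \<omega>\<close> for almost every \<open>\<omega>\<close>, and \<open>M 0\<close> is
  almost everywhere constant. Its value is the integral of each \<open>M n\<close>.\<close>

lemma initial_value:
  "\<exists>y. 0 \<le> y \<and> computes_real p no_oracle 0 y \<and> (\<forall>n. (\<integral>\<omega>. M n \<omega> \<partial>seq_measure) = y)"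
proof -
  have "initial_oracle (initial 0 \<omega>) = no_oracle" for \<omega>
    by (rule ext) (simp add: initial_oracle_initial no_oracle_def)
  then have *: "AE \<omega> in seq_measure. computes_real p no_oracle 0 (M 0 \<omega>)"
    using AE_computes[of 0] by simp
  have "\<exists>\<omega>. computes_real p no_oracle 0 (M 0 \<omega>)"
  proof (rule ccontr)
    assume "\<not> ?thesis"
    with * have "AE \<omega> in seq_measure. False" by simp
    then show False by simp
  qed
  then obtain \<omega>0 where \<omega>0: "computes_real p no_oracle 0 (M 0 \<omega>0)" ..
  have "AE \<omega> in seq_measure. M 0 \<omega> = M 0 \<omega>0"
    using * by eventually_elim (rule computes_real_unique[OF _ \<omega>0])
  then have 0: "(\<integral>\<omega>. M 0 \<omega> \<partial>seq_measure) = (\<integral>\<omega>. M 0 \<omega>0 \<partial>seq_measure)"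
    using M_integrable by (intro integral_cong_AE) auto
  have "(\<integral>\<omega>. M n \<omega> \<partial>seq_measure) = M 0 \<omega>0" for n
  proof -
    have "(\<integral>\<omega>. M n \<omega> \<partial>seq_measure) = (\<integral>\<omega>. cond_exp 0 (M n) \<omega> \<partial>seq_measure)"
      by (rule integral_cond_exp[OF M_integrable, symmetric])
    also have "\<dots> = (\<integral>\<omega>. M 0 \<omega> \<partial>seq_measure)"
      using M_cond_exp[of 0 n] M_integrable integrable_cond_exp[OF M_integrable]
      by (intro integral_cong_AE) auto
    finally show ?thesis using 0 by (simp add: seq.prob_space[simplified])
  qed
  then show ?thesis using \<omega>0 M_nonneg by blast
qed

lemma initial_value_approx:
  assumes "computes_real p no_oracle 0 y" "0 \<le> y"
  shows "\<exists>a. recursive (\<lambda>A. a) \<and> (\<forall>k. \<bar>real (a k) / 2 ^ k - y\<bar> \<le> 2 / 2 ^ k)"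
proof -
  let ?S = "\<lambda>k t. sim (\<lambda>_. 1) t p (prod_encode (0, k))"
  have ex: "\<exists>t. 0 < ?S k t" for k
  proof -
    from assms(1) obtain c where c: "run no_oracle p (prod_encode (0, k)) = Some c"
      unfolding computes_real_def by blast
    have "\<exists>t. ?S k t = Suc c"
      by (rule sim_complete[where Q = "\<lambda>_ _. 1" and A = no_oracle])
        (use c in \<open>auto simp: no_oracle_def\<close>)
    then show ?thesis by (metis zero_less_Suc)
  qed
  define T where "T k = (LEAST t. 0 < ?S k t)" for k
  have T: "0 < ?S k (T k)" for k unfolding T_def using ex by (rule LeastI_ex)
  have "decidable (\<lambda>A z. 0 < ?S (pfst z) (psnd z))"
    by (intro rec_intros recursive_sim[where Q = "\<lambda>_ _ _. 1"])
  then have recT: "recursive (\<lambda>A. T)" unfolding T_def using ex by (rule recursive_LEAST)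
  have "recursive (\<lambda>A k. dyadic k (?S k (T k) - 1))"
    by (intro rec_intros recursive_sim[where Q = "\<lambda>_ _ _. 1"] recursive_comp[OF recT])
  moreover have "\<bar>real (dyadic k (?S k (T k) - 1)) / 2 ^ k - y\<bar> \<le> 2 / 2 ^ k" for k
  proof -
    from T[of k] obtain c where c: "?S k (T k) = Suc c" by (auto simp: gr0_conv_Suc)
    have "run no_oracle p (prod_encode (0, k)) = Some c"
      by (rule sim_sound[OF _ c]) (auto simp: no_oracle_def)
    with assms(1) have "\<bar>of_rat (nat_to_rat_surj c) - y\<bar> \<le> 1 / 2 ^ k"
      unfolding computes_real_def by (metis option.inject)
    from dyadic_approx_nonneg[OF this assms(2)] show ?thesis unfolding c by simp
  qed
  ultimately show ?thesis by blast
qed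

text \<open>By dominated convergence the mass of \<open>M n\<close> on decided points tends to
  \<open>y\<close>. In units of \<open>1 / 2 ^ prec n\<close> the average loses 1 there, 2 by
  approximating \<open>M n\<close> and 2 by using \<open>a\<close> for \<open>y\<close>; the
  allowance 8 covers these 5.\<close>

lemma stage_exists:
  assumes y: "\<And>n. (\<integral>\<omega>. M n \<omega> \<partial>seq_measure) = y"
    and a: "\<bar>a / 2 ^ prec n - y\<bar> \<le> 2 / 2 ^ prec n"
  shows "\<exists>t. real (\<Sum>s<2 ^ t. of_bool (out n t s = 0)) / 2 ^ t \<le> 1 / 2 ^ prec n \<and>
     a / 2 ^ prec n - 8 / 2 ^ prec n \<le> real (\<Sum>s<2 ^ t. approx n t s) / 2 ^ t / 2 ^ prec n"
proof -
  let ?e = "1 / 2 ^ prec n :: real"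
  let ?h = "\<lambda>t \<omega>. 0 < out n t (code t (join \<omega>))"
  let ?I = "\<lambda>t. \<integral>\<omega>. M n \<omega> * indicator {\<omega>. ?h t \<omega>} \<omega> \<partial>seq_measure"
  have e: "?e > 0" by simp
  have h_sets [measurable]: "{\<omega>. ?h t \<omega>} \<in> sets seq_measure" for t by (rule seq.sets_code)
  have M_meas [measurable]: "M n \<in> borel_measurable seq_measure" using M_integrable by auto
  have "(\<lambda>t. measure seq_measure {\<omega>\<in>space seq_measure. \<not> ?h t \<omega>}) \<longlonglongrightarrow> 0"
    using AE_out[of n] out_mono h_sets by (intro tendsto_prob_undecided seq.prob_space_axioms) simp_all
  moreover have "measure seq_measure {\<omega>\<in>space seq_measure. \<not> ?h t \<omega>} = real (\<Sum>s<2 ^ t. of_bool (out n t s = 0)) / 2 ^ t" for t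
    using seq.prob_code[of "\<lambda>s. out n t s = 0" t] by simp
  ultimately have "(\<lambda>t. real (\<Sum>s<2 ^ t. of_bool (out n t s = 0)) / 2 ^ t) \<longlonglongrightarrow> 0" by (simp only:)
  from order_tendstoD(2)[OF this e]
  have ev1: "\<forall>\<^sub>F t in sequentially. real (\<Sum>s<2 ^ t. of_bool (out n t s = 0)) / 2 ^ t < ?e" .
  have "?I \<longlonglongrightarrow> (\<integral>\<omega>. M n \<omega> \<partial>seq_measure)"
  proof (rule integral_dominated_convergence[where w = "M n"])
    show "AE \<omega> in seq_measure. (\<lambda>t. M n \<omega> * indicator {\<omega>. ?h t \<omega>} \<omega>) \<longlonglongrightarrow> M n \<omega>"
      using AE_out[of n]
    proof eventually_elim
      case (elim \<omega>)
      then obtain t where t: "?h t \<omega>" by blast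
      have "\<forall>\<^sub>F t in sequentially. M n \<omega> * indicator {\<omega>. ?h t \<omega>} \<omega> = M n \<omega>"
        using eventually_ge_at_top[of t] by eventually_elim (use out_mono[OF t] in auto)
      then show ?case by (rule tendsto_eventually)
    qed
    show "AE \<omega> in seq_measure. norm (M n \<omega> * indicator {\<omega>. ?h t \<omega>} \<omega>) \<le> M n \<omega>" for t
      using M_nonneg[of n] by (auto simp: indicator_def)
  qed (use M_integrable in auto)
  then have "?I \<longlonglongrightarrow> y" by (simp only: y)
  from order_tendstoD(1)[OF this, of "y - ?e"]
  have ev2: "\<forall>\<^sub>F t in sequentially. y - ?e < ?I t" by simp
  from eventually_happens[OF eventually_conj[OF ev1 ev2]] obtain t where
    t: "real (\<Sum>s<2 ^ t. of_bool (out n t s = 0)) / 2 ^ t < ?e" "y - ?e < ?I t" by auto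
  have "?I t - 2 * ?e = (\<integral>\<omega>. M n \<omega> * indicator {\<omega>. ?h t \<omega>} \<omega> - 2 * ?e \<partial>seq_measure)"
    using M_integrable by (subst Bochner_Integration.integral_diff)
      (auto simp: seq.prob_space[simplified] intro!: integrable_mult_indicator[where 'b = real, simplified] integrable_real_mult_indicator)
  also have "\<dots> \<le> (\<integral>\<omega>. real (approx n t (code t (join \<omega>))) / 2 ^ prec n \<partial>seq_measure)"
  proof (rule integral_mono_AE)
    show "integrable seq_measure (\<lambda>\<omega>. M n \<omega> * indicator {\<omega>. ?h t \<omega>} \<omega> - 2 * ?e)"
      using M_integrable by (auto intro!: integrable_real_mult_indicator)
    show "AE \<omega> in seq_measure. M n \<omega> * indicator {\<omega>. ?h t \<omega>} \<omega> - 2 * ?e \<le> real (approx n t (code t (join \<omega>))) / 2 ^ prec n"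
      using AE_computes[of n]
    proof eventually_elim
      case (elim \<omega>)
      show ?case
      proof (cases "?h t \<omega>")
        case True
        with approx_error[OF elim] have "\<bar>real (approx n t (code t (join \<omega>))) / 2 ^ prec n - M n \<omega>\<bar> \<le> 2 * ?e"
          by simp
        with True show ?thesis by simp
      next
        case False
        have "- (2 / 2 ^ prec n) \<le> (0::real)" by simp
        also have "0 \<le> real (approx n t (code t (join \<omega>))) / 2 ^ prec n" by simp
        finally show ?thesis using False by simp
      qed
    qed
  qed auto
  also have "\<dots> = real (\<Sum>s<2 ^ t. approx n t s) / 2 ^ t / 2 ^ prec n"
    using seq.integral_code[of "\<lambda>s. real (approx n t s) / 2 ^ prec n" t] by (simp add: sum_divide_distrib mult.commute)
  finally have *: "?I t - 2 * ?e \<le> real (\<Sum>s<2 ^ t. approx n t s) / 2 ^ t / 2 ^ prec n" .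
  have "a / 2 ^ prec n - 8 / 2 ^ prec n \<le> real (\<Sum>s<2 ^ t. approx n t s) / 2 ^ t / 2 ^ prec n"
  proof -
    have "2 / 2 ^ prec n = 2 * ?e" "8 / 2 ^ prec n = 8 * ?e" by simp_all
    with * t(2) a e show ?thesis by linarith
  qed
  with t(1) show ?thesis by (intro exI[of _ t]) simp
qed

text \<open>Decided points have error at most 2 units of \<open>1 / 2 ^ prec n\<close>, and
  undecided ones have approximant \<open>0\<close>, so the absolute error is at most
  \<open>M n\<close> minus the approximant plus 4 units. The integrals differ by at most 2 + 8
  units, in total 14, below the 16 stated.\<close>

lemma stage_L1:
  assumes y: "(\<integral>\<omega>. M n \<omega> \<partial>seq_measure) = y"
    and a: "\<bar>a / 2 ^ prec n - y\<bar> \<le> 2 / 2 ^ prec n"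
    and t: "a / 2 ^ prec n - 8 / 2 ^ prec n \<le> real (\<Sum>s<2 ^ t. approx n t s) / 2 ^ t / 2 ^ prec n"
  shows "(\<integral>\<omega>. \<bar>real (approx n t (code t (join \<omega>))) / 2 ^ prec n - M n \<omega>\<bar> \<partial>seq_measure) \<le> 16 / 2 ^ prec n"
proof -
  let ?f = "\<lambda>\<omega>. real (approx n t (code t (join \<omega>))) / 2 ^ prec n"
  let ?e = "1 / 2 ^ prec n :: real"
  have int_f: "integrable seq_measure ?f" by auto
  have "(\<integral>\<omega>. \<bar>?f \<omega> - M n \<omega>\<bar> \<partial>seq_measure) \<le> (\<integral>\<omega>. M n \<omega> - ?f \<omega> + 4 * ?e \<partial>seq_measure)"
  proof (rule integral_mono_AE)
    show "integrable seq_measure (\<lambda>\<omega>. \<bar>?f \<omega> - M n \<omega>\<bar>)" using int_f M_integrable by auto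
    show "integrable seq_measure (\<lambda>\<omega>. M n \<omega> - ?f \<omega> + 4 * ?e)" using int_f M_integrable by auto
    show "AE \<omega> in seq_measure. \<bar>?f \<omega> - M n \<omega>\<bar> \<le> M n \<omega> - ?f \<omega> + 4 * ?e"
      using AE_computes[of n]
    proof eventually_elim
      case (elim \<omega>)
      show ?case
      proof (cases "0 < out n t (code t (join \<omega>))")
        case True
        with approx_error[OF elim] have "\<bar>?f \<omega> - M n \<omega>\<bar> \<le> 2 * ?e" by simp
        then show ?thesis by linarith
      next
        case False
        then show ?thesis using M_nonneg[of n \<omega>] by (simp add: approx_def)
      qed
    qed
  qed
  also have "\<dots> = y - (\<integral>\<omega>. ?f \<omega> \<partial>seq_measure) + 4 * ?e"
    using int_f M_integrable by (simp add: y seq.prob_space[simplified])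
  also have "(\<integral>\<omega>. ?f \<omega> \<partial>seq_measure) = real (\<Sum>s<2 ^ t. approx n t s) / 2 ^ t / 2 ^ prec n"
    using seq.integral_code[of "\<lambda>s. real (approx n t s) / 2 ^ prec n" t] by (simp add: sum_divide_distrib mult.commute)
  finally have *: "(\<integral>\<omega>. \<bar>?f \<omega> - M n \<omega>\<bar> \<partial>seq_measure) \<le> y - real (\<Sum>s<2 ^ t. approx n t s) / 2 ^ t / 2 ^ prec n + 4 * ?e" .
  have "2 / 2 ^ prec n = 2 * ?e" "8 / 2 ^ prec n = 8 * ?e" "16 / 2 ^ prec n = 16 * ?e" "?e > 0" by simp_all
  with * a t show ?thesis by linarith
qed

text \<open>Both requirements compare computable rationals, with \<open>a (prec n)\<close> standing
  in for the real \<open>y\<close>, so the least suitable stage can be searched for.\<close>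

lemma stages:
  obtains T where "recursive (\<lambda>A. T)"
    "\<And>n. real (\<Sum>s<2 ^ T n. of_bool (out n (T n) s = 0)) / 2 ^ T n \<le> 1 / 2 ^ prec n"
    "\<And>n. (\<integral>\<omega>. \<bar>real (approx n (T n) (code (T n) (join \<omega>))) / 2 ^ prec n - M n \<omega>\<bar> \<partial>seq_measure) \<le> 16 / 2 ^ prec n"
proof -
  from initial_value obtain y where y: "0 \<le> y" "computes_real p no_oracle 0 y"
    "\<And>n. (\<integral>\<omega>. M n \<omega> \<partial>seq_measure) = y" by blast
  from initial_value_approx[OF y(2,1)] obtain a where a: "recursive (\<lambda>A. a)"
    "\<And>k. \<bar>real (a k) / 2 ^ k - y\<bar> \<le> 2 / 2 ^ k" by blast
  let ?P = "\<lambda>n t. real (\<Sum>s<2 ^ t. of_bool (out n t s = 0)) / 2 ^ t \<le> 1 / 2 ^ prec n \<and>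
     real (a (prec n)) / 2 ^ prec n - 8 / 2 ^ prec n \<le> real (\<Sum>s<2 ^ t. approx n t s) / 2 ^ t / 2 ^ prec n"
  have ex: "\<exists>t. ?P n t" for n by (rule stage_exists[OF y(3) a(2)])
  define T where "T n = (LEAST t. ?P n t)" for n
  have T: "?P n (T n)" for n unfolding T_def using ex by (rule LeastI_ex)
  have "decidable (\<lambda>A z. ?P (pfst z) (psnd z))"
    by (intro rec_intros recursive_comp[OF a(1)])
  then have "recursive (\<lambda>A. T)" unfolding T_def using ex by (rule recursive_LEAST)
  then show ?thesis
    by (rule that) (use T stage_L1[OF y(3) a(2)] in simp_all)
qed

end

section \<open>Assembly of the bounded computable martingale\<close>

context ae_martingale
begin

text \<open>The step functions are chosen independently of \<open>\<omega>\<close>; the resulting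
  martingale depends on it only through the natural number \<open>C0\<close>.\<close>

lemma bounded_computable_martingale:
  assumes schnorr: "schnorr_random \<omega>"
    and at: "\<And>n. computes_real p (initial_oracle (initial n \<omega>)) n (M n \<omega>)"
  shows "\<exists>N d. nonneg_martingale N \<and> computable_process N \<and> computable_real_seq d \<and>
    (\<forall>n. esssup seq_measure (\<lambda>\<xi>. ereal \<bar>N n \<xi>\<bar>) \<le> ereal (d n)) \<and>
    (convergent (\<lambda>n. N n \<omega>) \<longleftrightarrow> convergent (\<lambda>n. M n \<omega>))"
proof -
  obtain T where T: "recursive (\<lambda>A. T)"
    and T_out: "\<And>n. real (\<Sum>s<2 ^ T n. of_bool (out n (T n) s = 0)) / 2 ^ T n \<le> 1 / 2 ^ prec n"
    and T_L1: "\<And>n. (\<integral>\<omega>. \<bar>real (approx n (T n) (code (T n) (join \<omega>))) / 2 ^ prec n - M n \<omega>\<bar> \<partial>seq_measure) \<le> 16 / 2 ^ prec n"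
    by (rule stages) blast
  note [rec_intros] = recursive_comp[OF T]
  define F where "F n s = real (approx n (T n) s) / 2 ^ prec n" for n s
  define f where "f n \<xi> = F n (code (T n) (join \<xi>))" for n and \<xi> :: "nat \<Rightarrow> cantor"
  \<comment> \<open>The sum of all values is a crude bound for their maximum, but plainly
    recursive.\<close>
  define B where "B n = (\<Sum>s<2 ^ T n. F n s)" for n
  have "recursive_rat (\<lambda>A z. F (pfst z) (psnd z))" unfolding F_def by (intro rec_intros)
  note [rec_intros] = recursive_rat_comp2[OF this]
  have "recursive_rat (\<lambda>A. B)" unfolding B_def by (intro rec_intros)
  note [rec_intros] = recursive_rat_comp[OF this]
  have approximants: "approximants f B C" if "0 \<le> C" for C
  proof
    show "0 \<le> f n \<xi>" for n \<xi> by (simp add: f_def F_def)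
    show "f n \<xi> \<le> B n" for n \<xi>
      unfolding f_def B_def by (rule member_le_sum) (auto simp: F_def code_less)
    show "f n \<in> borel_measurable seq_measure" for n
      unfolding f_def[abs_def] using seq.integrable_code by blast
    show "f n \<xi> = f n \<xi>'" if "\<And>j. j < n \<Longrightarrow> \<xi> j = \<xi>' j" for n \<xi> \<xi>'
      using out_adapted[OF that] by (simp add: f_def F_def approx_def)
  qed fact
  \<comment> \<open>A provisional constant: \<open>predicted\<close> and \<open>defect\<close> are
    needed before \<open>C0\<close> can be chosen.\<close>
  interpret a: approximants f B 0 by (rule approximants) simp
  have f_int: "integrable seq_measure (f n)" for n unfolding f_def[abs_def] by (rule seq.integrable_code)
  have f_L1: "(\<integral>\<omega>. \<bar>f n \<omega> - M n \<omega>\<bar> \<partial>seq_measure) \<le> 16 / 2 ^ prec n" for n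
    using T_L1[of n] by (simp add: f_def F_def)

  define P where "P i s = (\<Sum>s'<2 ^ T (Suc i). F (Suc i) (splice i (T (Suc i)) s s')) / 2 ^ T (Suc i)" for i s
  have predicted: "approximants.predicted f i \<xi> = P i (code (T (Suc i)) (join \<xi>))" for i \<xi>
    unfolding a.predicted_def unfolding P_def f_def[abs_def] by (rule cond_exp_code)
  have "recursive_rat (\<lambda>A z. P (pfst z) (psnd z))" unfolding P_def by (intro rec_intros)
  note [rec_intros] = recursive_rat_comp2[OF this]

  have "\<exists>k. \<forall>n>k. \<not> 1 / 2 ^ n < a.defect n \<omega>"
  proof -
    \<comment> \<open>One prefix long enough to determine both \<open>f n\<close> and
      \<open>predicted n\<close>, hence the defect.\<close>
    define L where "L n = T n + T (Suc n)" for n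
    define c where "c n s \<longleftrightarrow> 1 / 2 ^ n < \<bar>P n (take_bit (T (Suc n)) s) - F n (take_bit (T n) s)\<bar>" for n s
    have recL: "recursive (\<lambda>A. L)" unfolding L_def by (intro rec_intros)
    have c: "c n (code (L n) (join \<xi>)) \<longleftrightarrow> 1 / 2 ^ n < a.defect n \<xi>" for n \<xi>
      unfolding c_def a.defect_def predicted f_def by (simp add: L_def take_bit_code)
    have "real (\<Sum>s<2 ^ L n. of_bool (c n s)) / 2 ^ L n \<le> 1 / 2 ^ n" for n
    proof -
      \<comment> \<open>\<open>M n\<close> is almost surely \<open>cond_exp n (M (Suc n))\<close>,
        so the contraction property applies.\<close>
      have M_eq: "(\<integral>\<xi>. \<bar>a.predicted n \<xi> - M n \<xi>\<bar> \<partial>seq_measure) \<le> (\<integral>\<xi>. \<bar>f (Suc n) \<xi> - M (Suc n) \<xi>\<bar> \<partial>seq_measure)"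
      proof -
        have "(\<integral>\<xi>. \<bar>a.predicted n \<xi> - M n \<xi>\<bar> \<partial>seq_measure) = (\<integral>\<xi>. \<bar>cond_exp n (f (Suc n)) \<xi> - cond_exp n (M (Suc n)) \<xi>\<bar> \<partial>seq_measure)"
        proof (rule integral_cong_AE)
          show "AE \<xi> in seq_measure. \<bar>a.predicted n \<xi> - M n \<xi>\<bar> = \<bar>cond_exp n (f (Suc n)) \<xi> - cond_exp n (M (Suc n)) \<xi>\<bar>"
            using M_cond_exp[of n "Suc n", simplified] by eventually_elim (simp add: a.predicted_def)
        qed (use M_integrable[THEN borel_measurable_integrable] f_int[THEN borel_measurable_integrable] in measurable)
        then show ?thesis using cond_exp_L1_contraction[OF f_int M_integrable] by simp
      qed
      have int: "integrable seq_measure (a.predicted n)" unfolding a.predicted_def by (rule integrable_cond_exp[OF f_int])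
      have int': "integrable seq_measure (a.defect n)"
        unfolding a.defect_def[abs_def] using int f_int by auto
      have "(\<integral>\<xi>. a.defect n \<xi> \<partial>seq_measure) \<le> (\<integral>\<xi>. \<bar>a.predicted n \<xi> - M n \<xi>\<bar> + \<bar>f n \<xi> - M n \<xi>\<bar> \<partial>seq_measure)"
        using int int' f_int M_integrable by (intro integral_mono) (auto simp: a.defect_def)
      also have "\<dots> = (\<integral>\<xi>. \<bar>a.predicted n \<xi> - M n \<xi>\<bar> \<partial>seq_measure) + (\<integral>\<xi>. \<bar>f n \<xi> - M n \<xi>\<bar> \<partial>seq_measure)"
        using int f_int M_integrable by (intro Bochner_Integration.integral_add) auto
      also have "\<dots> \<le> 16 / 2 ^ prec (Suc n) + 16 / 2 ^ prec n"
        using M_eq f_L1[of "Suc n"] f_L1[of n] by linarith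
      also have "\<dots> \<le> (1 / 2 ^ n) * (1 / 2 ^ n)"
      proof -
        define x :: real where "x = 2 ^ n * 2 ^ n"
        have "0 < x" by (simp add: x_def)
        have prec: "prec (Suc n) = 7 + (n + n)" "prec n = 5 + (n + n)" by (simp_all add: prec_def)
        have eqs: "2 ^ prec (Suc n) = 128 * x" "2 ^ prec n = 32 * x" "1 / 2 ^ n * (1 / 2 ^ n) = 1 / x"
          unfolding prec power_add x_def by simp_all
        show ?thesis unfolding eqs using \<open>0 < x\<close> by (simp add: divide_simps)
      qed
      finally have I: "(\<integral>\<xi>. a.defect n \<xi> \<partial>seq_measure) \<le> (1 / 2 ^ n) * (1 / 2 ^ n)" .
      \<comment> \<open>Markov's inequality spends one of the two factors \<open>1 / 2 ^ n\<close>
        on the threshold and leaves the other as the probability.\<close>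
      have "measure seq_measure {\<xi>\<in>space seq_measure. 1 / 2 ^ n \<le> a.defect n \<xi>} \<le> (\<integral>\<xi>. a.defect n \<xi> \<partial>seq_measure) / (1 / 2 ^ n)"
        by (rule integral_Markov_inequality_measure[where A = "space seq_measure"])
          (use int' a.defect_nonneg sets.top[of seq_measure] in auto)
      also have "\<dots> \<le> 1 / 2 ^ n"
        by (subst pos_divide_le_eq) (use I in simp_all)
      finally have "measure seq_measure {\<xi>\<in>space seq_measure. 1 / 2 ^ n \<le> a.defect n \<xi>} \<le> 1 / 2 ^ n" .
      moreover have "measure seq_measure {\<xi>. c n (code (L n) (join \<xi>))} \<le> measure seq_measure {\<xi>\<in>space seq_measure. 1 / 2 ^ n \<le> a.defect n \<xi>}"
      proof (rule seq.finite_measure_mono)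
        show "{\<xi>\<in>space seq_measure. 1 / 2 ^ n \<le> a.defect n \<xi>} \<in> sets seq_measure"
          using a.defect_measurable[of n] by measurable
      qed (auto simp: c)
      ultimately show ?thesis unfolding seq.prob_code[symmetric] by linarith
    qed
    moreover have "decidable (\<lambda>A z. c (pfst z) (psnd z))" unfolding c_def by (intro rec_intros)
    ultimately have "\<exists>k. \<forall>n>k. \<not> c n (code (L n) (join \<omega>))"
      using schnorr_Borel_Cantelli[OF schnorr _ recL] by blast
    then show ?thesis unfolding c .
  qed
  then obtain k where k: "\<And>n. k < n \<Longrightarrow> a.defect n \<omega> \<le> 1 / 2 ^ n" by (auto simp: not_less)
  have summable: "summable (\<lambda>n. a.defect n \<omega>)"
    by (rule summable_comparison_test'[OF summable_geometric[of "1/2::real"], of "Suc k"])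
      (use k in \<open>auto simp: a.defect_def power_one_over\<close>)
  \<comment> \<open>Rounding up to a natural number gives a constant that a program can contain,
    whether or not the sum is computable.\<close>
  define C0 where "C0 = nat \<lceil>\<Sum>n. a.defect n \<omega>\<rceil>"
  have C0: "(\<Sum>j<n. a.defect j \<omega>) \<le> real C0" for n
  proof -
    have "(\<Sum>j<n. a.defect j \<omega>) \<le> (\<Sum>n. a.defect n \<omega>)"
      using summable by (intro sum_le_suminf) (auto simp: a.defect_def)
    then show ?thesis unfolding C0_def by linarith
  qed
  interpret b: approximants f B "real C0" by (rule approximants) simp

  have conv_f: "convergent (\<lambda>n. f n \<omega>) \<longleftrightarrow> convergent (\<lambda>n. M n \<omega>)"
  proof -
    \<comment> \<open>From some index on, the value \<open>f n \<omega>\<close> comes from a halted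
      computation, so it is within rounding error of \<open>M n \<omega>\<close>.\<close>
    have "\<exists>k. \<forall>n>k. \<not> out n (T n) (code (T n) (join \<omega>)) = 0"
    proof (rule schnorr_Borel_Cantelli[OF schnorr _ T, where c = "\<lambda>n s. out n (T n) s = 0"])
      show "decidable (\<lambda>A z. out (pfst z) (T (pfst z)) (psnd z) = 0)" by (intro rec_intros)
      show "real (\<Sum>s<2 ^ T n. of_bool (out n (T n) s = 0)) / 2 ^ T n \<le> 1 / 2 ^ n" for n
        by (rule order.trans[OF T_out]) (auto simp: prec_def intro!: divide_left_mono power_increasing)
    qed
    then obtain k' where k': "\<And>n. k' < n \<Longrightarrow> 0 < out n (T n) (code (T n) (join \<omega>))" by auto
    have bound: "\<bar>f n \<omega> - M n \<omega>\<bar> \<le> 1 / 2 ^ n" if "k' < n" for n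
    proof -
      have "\<bar>f n \<omega> - M n \<omega>\<bar> \<le> 2 / 2 ^ prec n"
        using approx_error[OF at k'[OF that]] by (simp add: f_def F_def)
      also have "\<dots> \<le> 1 / 2 ^ n"
      proof -
        have "(2::real) ^ Suc n \<le> 2 ^ prec n" by (rule power_increasing) (auto simp: prec_def)
        then show ?thesis by (simp add: field_simps)
      qed
      finally show ?thesis .
    qed
    have "(\<lambda>n. f n \<omega> - M n \<omega>) \<longlonglongrightarrow> 0"
    proof (rule Lim_null_comparison)
      show "\<forall>\<^sub>F n in sequentially. norm (f n \<omega> - M n \<omega>) \<le> (1/2) ^ n"
        using eventually_gt_at_top[of k'] by eventually_elim (use bound in \<open>auto simp: power_one_over\<close>)
      show "(\<lambda>n. (1/2::real) ^ n) \<longlonglongrightarrow> 0" by (rule LIMSEQ_realpow_zero) auto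
    qed
    then have *: "convergent (\<lambda>n. f n \<omega> - M n \<omega>)" by (rule convergentI)
    show ?thesis
    proof
      assume "convergent (\<lambda>n. f n \<omega>)"
      from convergent_diff[OF this *] show "convergent (\<lambda>n. M n \<omega>)" by simp
    next
      assume "convergent (\<lambda>n. M n \<omega>)"
      from convergent_add[OF this *] show "convergent (\<lambda>n. f n \<omega>)" by simp
    qed
  qed
  have conv: "convergent (\<lambda>n. b.stopped n \<omega>) \<longleftrightarrow> convergent (\<lambda>n. M n \<omega>)"
    using b.convergent_stopped_iff[OF C0] conv_f by simp

  \<comment> \<open>The stopped process as a functional of an arbitrary oracle, with
    \<open>0 < A m\<close> read as bit \<open>m\<close> of the join.\<close>
  define N where "N A n = real C0 + F 0 (code (T 0) (\<lambda>m. 0 < A m)) +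
      (\<Sum>i<n. if (\<Sum>j<Suc i. \<bar>P j (code (T (Suc j)) (\<lambda>m. 0 < A m)) - F j (code (T j) (\<lambda>m. 0 < A m))\<bar>) \<le> real C0
        then F (Suc i) (code (T (Suc i)) (\<lambda>m. 0 < A m)) - P i (code (T (Suc i)) (\<lambda>m. 0 < A m)) else 0)"
    for A :: "nat \<Rightarrow> nat" and n
  have N: "b.stopped n \<xi> = N (initial_oracle (initial n \<xi>)) n" for n \<xi>
  proof -
    \<comment> \<open>\<open>initial_oracle\<close> answers \<open>0\<close> outside the first
      \<open>n\<close> rows, so it describes \<open>\<zeta>\<close> rather than
      \<open>\<xi>\<close>; adaptedness passes from one to the other.\<close>
    define \<zeta> where "\<zeta> j = (if j < n then \<xi> j else (\<lambda>_. False))" for j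
    have join: "join \<zeta> = (\<lambda>m. 0 < initial_oracle (initial n \<xi>) m)"
      by (rule ext) (simp add: initial_oracle_initial \<zeta>_def join_def pfst_def)
    have "b.stopped n \<xi> = b.stopped n \<zeta>" by (rule b.stopped_adapted) (simp add: \<zeta>_def)
    also have "\<dots> = N (initial_oracle (initial n \<xi>)) n"
      unfolding b.stopped_def b.defect_def predicted f_def N_def join ..
    finally show ?thesis .
  qed
  have recN: "recursive_rat (\<lambda>A z. N A (pfst z))" unfolding N_def
    by (intro rec_intros)
  have "computable_process b.stopped"
  proof -
    from recursive_rat_code[OF recN] obtain r where r: "recursive r"
      "\<And>A x. of_rat (nat_to_rat_surj (r A x)) = N A (pfst x)" by blast
    then obtain q where q: "\<And>A x. run A q x = Some (r A x)" unfolding recursive_def by blast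
    \<comment> \<open>The value is an exact rational, so the Cauchy name is constant in the
      precision.\<close>
    show ?thesis unfolding computable_process_def computes_real_def
      by (intro exI[of _ q]) (simp add: q r(2) N)
  qed
  moreover have "nonneg_martingale b.stopped"
  proof (rule b.stopped_martingale)
    show "\<exists>g. \<forall>\<xi>. b.stopped n \<xi> = g (initial n \<xi>)" for n
      by (intro exI[of _ "\<lambda>xs. N (initial_oracle xs) n"]) (simp add: N)
  qed
  moreover define d where "d n = real C0 + B 0 + (\<Sum>i<n. B (Suc i))" for n
  have "computable_real_seq d"
  proof -
    have "recursive_rat (\<lambda>A z. d (pfst z))" unfolding d_def by (intro rec_intros)
    from recursive_rat_code[OF this] obtain r where r: "recursive r"
      "\<And>A x. of_rat (nat_to_rat_surj (r A x)) = d (pfst x)" by blast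
    then obtain q where q: "\<And>A x. run A q x = Some (r A x)" unfolding recursive_def by blast
    show ?thesis unfolding computable_real_seq_def computes_real_def
      by (intro exI[of _ q]) (simp add: q r(2))
  qed
  moreover have "esssup seq_measure (\<lambda>\<xi>. ereal \<bar>b.stopped n \<xi>\<bar>) \<le> ereal (d n)" for n
    by (rule esssup_I) (use b.stopped_abs_le in \<open>auto simp: d_def\<close>)
  ultimately show ?thesis using conv by blast
qed

end

section \<open>The equivalences\<close>

lemma Pi02_UNIV: "Pi02 UNIV"
proof -
  \<comment> \<open>\<open>ZeroP\<close> halts on every string, in particular on the empty one,
    whose cylinder is the whole space.\<close>
  have "effectively_open_seq (\<lambda>_. UNIV)"
    unfolding effectively_open_seq_def by (intro exI[of _ ZeroP]) (auto simp: cylinder_def intro!: exI[of _ "[]"])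
  then show ?thesis unfolding Pi02_def by (intro exI[of _ "\<lambda>_. UNIV"]) auto
qed

theorem theorem4p16:
  fixes \<omega> :: "nat \<Rightarrow> nat \<Rightarrow> bool"
  assumes schnorr: "schnorr_random \<omega>"
  shows "((\<exists>M d. nonneg_martingale M \<and> computable_process M \<and> computable_real_seq d \<and>
             (\<forall>n. esssup seq_measure (\<lambda>\<xi>. ereal \<bar>M n \<xi>\<bar>) \<le> ereal (d n)) \<and>
             \<not> convergent (\<lambda>n. M n \<omega>))
          \<longleftrightarrow> \<not> doob_random \<omega>)
       \<and> (\<not> doob_random \<omega>
          \<longleftrightarrow> (\<exists>M. nonneg_martingale M \<and> ae_computable_process M \<and>
             \<not> convergent (\<lambda>n. M n \<omega>)))" (is "(?A \<longleftrightarrow> ?B) \<and> (?B \<longleftrightarrow> ?C)")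
proof -
  have "?A \<Longrightarrow> ?B" unfolding doob_random_def by blast
  moreover have "?B \<Longrightarrow> ?C"
  proof -
    assume ?B
    then obtain M where M: "nonneg_martingale M" "computable_process M" "\<not> convergent (\<lambda>n. M n \<omega>)"
      unfolding doob_random_def by blast
    have "measure seq_measure UNIV = 1" using seq.prob_space by simp
    with M(2) Pi02_UNIV have "ae_computable_process M"
      unfolding computable_process_def ae_computable_process_def by blast
    with M show ?C by blast
  qed
  moreover have "?C \<Longrightarrow> ?A"
  proof -
    assume ?C
    then obtain M where mart: "nonneg_martingale M" and ae: "ae_computable_process M"
      and div: "\<not> convergent (\<lambda>n. M n \<omega>)" by blast
    from ae obtain p where p: "\<And>n. \<exists>D. Pi02 D \<and> measure seq_measure D = 1 \<and>
        (\<forall>\<xi>\<in>D. computes_real p (initial_oracle (initial n \<xi>)) n (M n \<xi>))"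
      unfolding ae_computable_process_def by blast
    interpret ae_martingale M p
    proof
      show "AE \<xi> in seq_measure. computes_real p (initial_oracle (initial n \<xi>)) n (M n \<xi>)" for n
      proof -
        from p[of n] obtain D where D: "measure seq_measure D = 1"
          "\<And>\<xi>. \<xi> \<in> D \<Longrightarrow> computes_real p (initial_oracle (initial n \<xi>)) n (M n \<xi>)" by blast
        from D(1) have "AE \<xi> in seq_measure. \<xi> \<in> D" by (rule seq.AE_prob_1)
        then show ?thesis by eventually_elim (rule D(2))
      qed
    qed (rule mart)
    \<comment> \<open>The computation also succeeds at \<open>\<omega>\<close> itself, because
      Schnorr random points lie in every \<open>Pi02\<close> set of measure one.\<close>
    have "computes_real p (initial_oracle (initial n \<omega>)) n (M n \<omega>)" for n
      using p[of n] schnorr_mem_Pi02[OF schnorr] by blast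
    from bounded_computable_martingale[OF schnorr this] div show ?A by blast
  qed
  ultimately show ?thesis by blast
qed

end
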